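(* Let $(\Omega,\mathcal F,\mathbb P)$ be a probability space, let $\mathfrak d,\delta,J\in\mathbb N$, let $U_{n,j}\colon\Omega\to\mathbb R^\delta$, $n\in\mathbb N_0$, $j\in\{1,\dots,J\}$, be i.i.d. random variables, let $G\colon\mathbb R^{\mathfrak d}\times\mathbb R^\delta\to\mathbb R^{\mathfrak d}$ be measurable, assume for all $\theta\in\mathbb R^{\mathfrak d}$ that $\mathbb E[\|G(\theta,U_{0,1})\|]<\infty$, let $\alpha\in[0,1)$, $\nu\in\mathbb R^{\mathfrak d}$, let $(\gamma_n)_{n\in\mathbb N_0}\subseteq(0,\infty)$, and let $\Theta,\mathbf m\colon\mathbb N_0\times\Omega\to\mathbb R^{\mathfrak d}$ be stochastic processes which satisfy for all $n\in\mathbb N$ that $$\mathbf m_0=\nu,\qquad \Theta_n=\Theta_{n-1}+\gamma_n\mathbf m_n,\qquad \mathbf m_n=\alpha\mathbf m_{n-1}+(1-\alpha)\Bigl[\frac1J\sum_{j=1}^JG(\Theta_{n-1},U_{n,j})\Bigr].$$ Assume that $\Theta_0$ and $(U_{n,j})_{n\in\mathbb N_0,\,j\in\{1,\dots,J\}}$ are independent, assume $\mathbb E[\|\Theta_0\|^2]<\infty$, for every $n\in\mathbb N_0$ let $\mathcal F_n=\sigma(\{\Theta_k\colon k\in\{0,1,\dots,n\}\})$, assume for all $n\in\mathbb N$, $j\in\{1,\dots,J\}$ that $U_{n,j}$ is independent of $\mathcal F_{n-1}$, and let $\mathfrak c\in[0,\infty)$ satisfy $\mathfrak c\ge\sup_{n\in\mathbb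 N_0}(\mathbb E[\|G(\Theta_n,U_{0,1})\|^2])^{1/2}$. Let $c\in(0,\infty)$, $\vartheta\in\mathbb R^{\mathfrak d}$ satisfy for all $\theta\in\mathbb R^{\mathfrak d}$ that $$\langle\theta-\vartheta,\mathbb E[G(\theta,U_{1,1})]\rangle\le-c\max\{\|\theta-\vartheta\|^2,\|\mathbb E[G(\theta,U_{1,1})]\|^2\}.$$ Let $\Gamma\in(0,\infty)$, assume for all $n\in\mathbb N$ that $\gamma_n=\Gamma n^{-1}$, let $\rho=(1-\alpha)c\Gamma$, let $$\widehat N=\Bigl\lceil\max\Bigl\{2,\tfrac{2(1+\alpha)c\Gamma}{1-\alpha},\tfrac{2(2-\alpha)(J-1+\alpha)\Gamma}{(1-\alpha)^2c^3J}\Bigr\}\Bigr\rceil,$$ and for every $n\in\mathbb N_0$ let $V_n\in[0,\infty)$ satisfy $$V_n=\mathbb E[\|\Theta_n-\vartheta\|^2]+\frac{1+\alpha}{1-\alpha}\gamma_n\max\{\mathbb E[\langle\Theta_n-\vartheta,\mathbf m_n\rangle],0\}+\frac{2}{(1-\alpha)^2}\gamma_n^2\,\mathbb E[\|\mathbf m_n\|^2].$$ Then for all $n\in\mathbb N\cap[2,\infty)$ with $n\ge\widehat N$ it holds that $$\mathbb E[\|\Theta_n-\vartheta\|^2]\le\begin{cases}V_{\widehat N-1}\Bigl(\dfrac{\widehat N}{n+1}\Bigr)^{\rho}+\Bigl(\dfrac{2^{\rho+1}\Gamma^2(2-\alpha)\mathfrak c^2}{(1-\rho)(\widehat N-1)^{1-\rho}}\Bigr)\dfrac{1}{J(n+1)^{\rho}}&\colon\rho<1,\\[3mm]V_{\widehat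 N-1}\Bigl(\dfrac{\widehat N}{n+1}\Bigr)+\bigl(2\Gamma^2(2-\alpha)\mathfrak c^2\bigr)\Bigl[\dfrac1{\widehat N}+\log\Bigl(\dfrac n{\widehat N}\Bigr)\Bigr]\dfrac1{Jn}&\colon\rho=1,\\[3mm]V_{\widehat N-1}\Bigl(\dfrac{\widehat N}{n+1}\Bigr)^{\rho}+\Bigl(\dfrac{2\Gamma^2(2-\alpha)\mathfrak c^2}{\rho-1}\Bigr)\dfrac1{Jn}&\colon\rho>1.\end{cases}$$
   Context: $\mathbb N=\{1,2,3,\dots\}$, $\mathbb N_0=\{0,1,2,\dots\}$; $\langle\cdot,\cdot\rangle$ and $\|\cdot\|$ are the standard Euclidean inner product and norm; $\log$ is the natural logarithm. For a process $X\colon\mathbb N_0\times\Omega\to\mathbb R^{\mathfrak d}$, $X_n$ denotes $X(n,\cdot)$. *)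

theory Defs
  imports "HOL-Probability.Probability"
begin

definition natural_filtration ::
    "'w measure \<Rightarrow> (nat \<Rightarrow> 'w \<Rightarrow> 'a::topological_space) \<Rightarrow> nat \<Rightarrow> 'w measure" where
  "natural_filtration M X n =
     sigma (space M) {X k -` A \<inter> space M |k A. k \<le> n \<and> A \<in> sets borel}"

text \<open>A measure serves only as a carrier of its sigma-algebra here. Independence of two random
  variables is expressed by taking for \<open>F\<close> the sigma-algebra generated by the second one; the
  library's \<open>indep_var\<close> would force both to have the same value type.\<close>

definition indep_of_sigma ::
    "'w measure \<Rightarrow> ('w \<Rightarrow> 'a::topological_space) \<Rightarrow> 'w measure \<Rightarrow> bool" where
  "indep_of_sigma M X F \<longleftrightarrow>
     prob_space.indep_set M (sets (vimage_algebra (space M) X borel)) (sets F)"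

definition iid_family ::
    "'w measure \<Rightarrow> ('i \<Rightarrow> 'w \<Rightarrow> 'a::topological_space) \<Rightarrow> 'i set \<Rightarrow> bool" where
  "iid_family M X I \<longleftrightarrow>
     prob_space.indep_vars M (\<lambda>_. borel) X I \<and>
     (\<forall>i\<in>I. \<forall>k\<in>I. distr M borel (X i) = distr M borel (X k))"

end

theory Submission
  imports Defs
begin

text \<open>The sequence \<open>V\<close> is a Lyapunov function. Since the noise of step \<open>n\<close> is independent of
  everything built from \<open>\<Theta> 0\<close> and the earlier noise, averaging over it replaces \<open>G\<close> by its mean \<open>g\<close>,
  which closes a system of recursions for the second moment of the error, its correlation with the
  momentum, and the second moment of the momentum. The weights in \<open>V\<close> are chosen so that these
  combine, once the step size is small, into
  \<open>V n \<le> (1 - \<rho> / n) * V (n - 1) + B / n\<^sup>2\<close> with \<open>B = 2 * \<Gamma>\<^sup>2 * (2 - \<alpha>) * \<cc>\<^sup>2 / J\<close>;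
  solving this scalar recursion gives the three regimes of \<open>\<rho>\<close>.\<close>

subsection \<open>Scalar recursions\<close>

text \<open>The correlation may have either sign, so an expression linear in it need not dominate
  the error. Its positive part in \<open>V\<close> secures \<open>err n \<le> V n\<close>, at the
  price of a case distinction on the sign of the new correlation. Leaving the gradient part of the
  momentum recursion aside, one step shrinks the contributions of error, positive correlation and
  momentum by relative amounts \<open>2 * (1 - \<alpha>) * c * \<gamma>\<close>,
  \<open>(1 - \<alpha>)\<^sup>2 / (1 + \<alpha>)\<close> and \<open>(1 - \<alpha>)\<^sup>2\<close>.
  Half of the first amount absorbs the gradient part; the other half is \<open>\<rho> / n\<close>.
  The entries of \<open>N\<close> beyond 2 ensure that this half can be spared and that the other
  two contributions shrink at least as fast. A second obstacle is the minibatch: its cross terms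
  multiply two samples of the same step, so one of them has to be averaged while the other already
  counts as known. Histories are therefore indexed by sets of noise variables rather than by
  time.\<close>

lemma powr_ratio_mult:
  fixes x y z \<rho> :: real
  assumes "0 < x" "0 < y" "0 < z"
  shows "(x / y) powr \<rho> * (z / x) powr \<rho> = (z / y) powr \<rho>"
  using assms by (simp add: powr_mult[symmetric])

text \<open>The number \<open>exp (- (\<rho> / n))\<close> lies between the two sides. Products of
  the powers on the right telescope, so the homogeneous part of the recursion is controlled in
  closed form.\<close>

lemma one_minus_le_powr:
  fixes n \<rho> :: real
  assumes "0 < n" "0 \<le> \<rho>"
  shows "1 - \<rho> / n \<le> (n / (n + 1)) powr \<rho>"
proof -
  have "ln ((n + 1) / n) \<le> (n + 1) / n - 1"
    using assms by (intro ln_le_minus_one) simp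
  also have "\<dots> = 1 / n" using assms by (simp add: field_simps)
  finally have "- (1 / n) \<le> ln (n / (n + 1))"
    using assms by (simp add: ln_div)
  then have "\<rho> * (- (1 / n)) \<le> \<rho> * ln (n / (n + 1))"
    using assms(2) by (rule mult_left_mono)
  then have "exp (- (\<rho> / n)) \<le> (n / (n + 1)) powr \<rho>"
    using assms by (simp add: powr_def)
  moreover have "1 + (- (\<rho> / n)) \<le> exp (- (\<rho> / n))" by (rule exp_ge_add_one_self)
  ultimately show ?thesis by simp
qed

text \<open>The right side is the integral of \<open>x powr (\<rho> - 2)\<close> over the interval
  from \<open>n - 1\<close> to \<open>n\<close>, whose integrand is decreasing. Two uses of the
  tangent bound for \<open>exp\<close> and \<open>ln\<close> replace the integration.\<close>

lemma powr_telescope_bound: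
  fixes n \<rho> :: real
  assumes "1 < n" "\<rho> < 1"
  shows "n powr (\<rho> - 2) \<le> ((n - 1) powr (\<rho> - 1) - n powr (\<rho> - 1)) / (1 - \<rho>)"
proof -
  have "ln ((n - 1) / n) \<le> (n - 1) / n - 1"
    using assms by (intro ln_le_minus_one) simp
  also have "\<dots> = - (1 / n)" using assms by (simp add: field_simps)
  finally have "(1 - \<rho>) * ln ((n - 1) / n) \<le> (1 - \<rho>) * - (1 / n)"
    using assms by (intro mult_left_mono) auto
  then have "(1 - \<rho>) / n \<le> (\<rho> - 1) * ln ((n - 1) / n)"
    by (simp add: algebra_simps)
  then have "exp ((1 - \<rho>) / n) \<le> ((n - 1) / n) powr (\<rho> - 1)"
    using assms by (simp add: powr_def)
  moreover have "1 + (1 - \<rho>) / n \<le> exp ((1 - \<rho>) / n)" by (rule exp_ge_add_one_self)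
  ultimately have "1 + (1 - \<rho>) / n \<le> ((n - 1) / n) powr (\<rho> - 1)" by linarith
  then have "n powr (\<rho> - 1) * (1 + (1 - \<rho>) / n)
      \<le> n powr (\<rho> - 1) * ((n - 1) / n) powr (\<rho> - 1)"
    by (intro mult_left_mono) auto
  also have "\<dots> = (n - 1) powr (\<rho> - 1)"
    using assms by (simp add: powr_mult[symmetric])
  finally have "n powr (\<rho> - 1) * (1 + (1 - \<rho>) / n) \<le> (n - 1) powr (\<rho> - 1)" .
  moreover have "n powr (\<rho> - 2) = n powr (\<rho> - 1) / n"
    using assms powr_diff[of n "\<rho> - 1" 1] by simp
  ultimately have "n powr (\<rho> - 2) * (1 - \<rho>) \<le> (n - 1) powr (\<rho> - 1) - n powr (\<rho> - 1)"
    by (simp add: distrib_left)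
  then show ?thesis
    using assms by (simp only: pos_le_divide_eq)
qed

text \<open>This expresses the forcing term in the scale of the homogeneous solution one index
  later. The shift costs \<open>((x + 1) / x) powr \<rho>\<close>, at most
  \<open>2 powr \<rho>\<close>, which is where that factor of the rate for \<open>\<rho> < 1\<close>
  comes from.\<close>

lemma inverse_square_le_powr:
  fixes x \<rho> :: real
  assumes "1 \<le> x" "0 \<le> \<rho>"
  shows "(1 / x)\<^sup>2 \<le> 2 powr \<rho> * x powr (\<rho> - 2) * (1 / (x + 1)) powr \<rho>"
proof -
  have x: "0 < x" "0 < x + 1" using assms by auto
  have sq: "(1 / x)\<^sup>2 = x powr (\<rho> - 2) * (1 / x) powr \<rho>"
  proof -
    have "x powr (\<rho> - 2) = x powr \<rho> / x\<^sup>2"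
      using x powr_diff[of x \<rho> 2] by simp
    moreover have "(1 / x) powr \<rho> = 1 / x powr \<rho>"
      using x powr_divide[of 1 x \<rho>] by simp
    ultimately show ?thesis using x by (simp add: power_one_over)
  qed
  have "(1 / x) powr \<rho> = ((x + 1) / x) powr \<rho> * (1 / (x + 1)) powr \<rho>"
    using powr_ratio_mult[of "x + 1" x 1 \<rho>] x by simp
  also have "\<dots> \<le> 2 powr \<rho> * (1 / (x + 1)) powr \<rho>"
    using assms by (intro mult_right_mono powr_mono2) (auto simp: divide_le_eq)
  finally have "x powr (\<rho> - 2) * (1 / x) powr \<rho>
      \<le> x powr (\<rho> - 2) * (2 powr \<rho> * (1 / (x + 1)) powr \<rho>)"
    by (rule mult_left_mono) simp
  then show ?thesis unfolding sq by (simp only: mult.assoc mult.left_commute)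
qed

text \<open>Relative to the homogeneous solution, which decays like \<open>k powr - \<rho>\<close>,
  the forcing has size \<open>k powr (\<rho> - 2)\<close>. For \<open>\<rho> < 1\<close> this is
  summable, so the initial value and the noise decay at the same rate.\<close>

lemma recursion_bound_lt_1:
  fixes v :: "nat \<Rightarrow> real" and N n :: nat
  assumes N: "N \<ge> 2" and v0: "0 \<le> v (N - 1)" and B: "0 \<le> B" and \<rho>: "0 < \<rho>" "\<rho> < 1"
    and step: "\<And>k. k \<ge> N \<Longrightarrow> v k \<le> (1 - \<rho> / real k) * v (k - 1) + B / (real k)\<^sup>2"
    and n: "n \<ge> N"
  shows "v n \<le> v (N - 1) * (real N / (real n + 1)) powr \<rho>
     + 2 powr \<rho> * B / ((1 - \<rho>) * (real N - 1) powr (1 - \<rho>)) * (1 / (real n + 1) powr \<rho>)"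
proof -
  \<comment> \<open>The integral of \<open>x powr (\<rho> - 2)\<close> from \<open>N - 1\<close> to
    \<open>k\<close>, a majorant for the accumulated forcing.\<close>
  define T where "T k = ((real N - 1) powr (\<rho> - 1) - real k powr (\<rho> - 1)) / (1 - \<rho>)" for k
  \<comment> \<open>The induction can start at \<open>N - 1\<close>, one index before the recursion
    applies: there the ratio equals 1 and \<open>T\<close> vanishes.\<close>
  have "v k \<le> v (N - 1) * (real N / (real k + 1)) powr \<rho>
      + 2 powr \<rho> * B * T k * (1 / (real k + 1)) powr \<rho>" if "k \<ge> N - 1" for k
    using that
  proof (induction k rule: dec_induct)
    case base
    show ?case using N by (simp add: T_def)
  next
    case (step j)
    let ?k = "real j + 1"
    have k: "Suc j \<ge> N" "?k > 1" "real j > 0" using step(1) N by auto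
    have T_Suc: "?k powr (\<rho> - 2) + T j \<le> T (Suc j)"
    proof -
      have "T (Suc j) - T j = (real j powr (\<rho> - 1) - ?k powr (\<rho> - 1)) / (1 - \<rho>)"
        unfolding T_def by (simp add: diff_divide_distrib add.commute)
      then show ?thesis using powr_telescope_bound[OF k(2) \<rho>(2)] by simp
    qed
    have k_sq: "(1 / ?k)\<^sup>2 \<le> 2 powr \<rho> * ?k powr (\<rho> - 2) * (1 / (?k + 1)) powr \<rho>"
      using k \<rho> by (intro inverse_square_le_powr) auto
    have T: "(1 / ?k)\<^sup>2 + 2 powr \<rho> * T j * (1 / (?k + 1)) powr \<rho>
        \<le> 2 powr \<rho> * T (Suc j) * (1 / (?k + 1)) powr \<rho>"
    proof -
      have "Q + P * t * Y \<le> P * t' * Y" if "X + t \<le> t'" "Q \<le> P * X * Y" "0 \<le> P" "0 \<le> Y"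
        for P Q X Y t t' :: real
        using that mult_right_mono[of "X + t" t' "P * Y"] by (simp add: algebra_simps)
      from this[OF T_Suc k_sq powr_ge_zero powr_ge_zero] show ?thesis .
    qed
    let ?R = "v (N - 1) * (real N / ?k) powr \<rho> + 2 powr \<rho> * B * T j * (1 / ?k) powr \<rho>"
    have Tj: "T j \<ge> 0" unfolding T_def
      using step(1) N \<rho> by (intro divide_nonneg_nonneg) (auto intro!: powr_mono2')
    \<comment> \<open>The induction hypothesis may only be multiplied by a nonnegative factor; the
      factor is relaxed to the telescoping power afterwards, which in turn needs \<open>?R\<close>
      to be nonnegative.\<close>
    have "\<rho> / ?k \<le> 1" using k \<rho> by (simp add: field_simps)
    then have "(1 - \<rho> / ?k) * v j \<le> (1 - \<rho> / ?k) * ?R"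
      by (intro mult_left_mono step(3)) simp
    moreover have "v (Suc j) \<le> (1 - \<rho> / ?k) * v j + B / ?k\<^sup>2"
      using assms(6)[OF k(1)] by (simp add: add.commute)
    ultimately have "v (Suc j) \<le> (1 - \<rho> / ?k) * ?R + B / ?k\<^sup>2" by linarith
    also have "(1 - \<rho> / ?k) * ?R \<le> (?k / (?k + 1)) powr \<rho> * ?R"
      using one_minus_le_powr[of ?k \<rho>] k \<rho> v0 B Tj by (intro mult_right_mono) auto
    also have "\<dots> = v (N - 1) * (real N / (?k + 1)) powr \<rho>
        + 2 powr \<rho> * B * T j * (1 / (?k + 1)) powr \<rho>"
    proof -
      have "(?k / (?k + 1)) powr \<rho> * (real N / ?k) powr \<rho> = (real N / (?k + 1)) powr \<rho>"
          "(?k / (?k + 1)) powr \<rho> * (1 / ?k) powr \<rho> = (1 / (?k + 1)) powr \<rho>"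
        using k N by (intro powr_ratio_mult; simp)+
      moreover have "y * (V * s + P * B' * t * z) = V * (y * s) + P * B' * t * (y * z)"
        for y V s P B' t z :: real by (simp add: algebra_simps)
      ultimately show ?thesis by simp
    qed
    finally have "v (Suc j) \<le> v (N - 1) * (real N / (?k + 1)) powr \<rho>
        + B * ((1 / ?k)\<^sup>2 + 2 powr \<rho> * T j * (1 / (?k + 1)) powr \<rho>)"
      by (simp add: distrib_left power_one_over mult.assoc mult.left_commute[of B])
    also have "\<dots> \<le> v (N - 1) * (real N / (?k + 1)) powr \<rho>
        + B * (2 powr \<rho> * T (Suc j) * (1 / (?k + 1)) powr \<rho>)"
      by (intro add_left_mono mult_left_mono T B)
    finally show ?case by (simp add: add.commute mult.assoc mult.left_commute[of B])
  qed
  from this[of n] have "v n \<le> v (N - 1) * (real N / (real n + 1)) powr \<rho>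
      + 2 powr \<rho> * B * T n * (1 / (real n + 1)) powr \<rho>" using n by simp
  also have "2 powr \<rho> * B * T n * (1 / (real n + 1)) powr \<rho>
      \<le> 2 powr \<rho> * B * ((real N - 1) powr (\<rho> - 1) / (1 - \<rho>)) * (1 / (real n + 1)) powr \<rho>"
    using \<rho> B by (intro mult_right_mono mult_left_mono) (auto simp: T_def divide_simps)
  also have "(real N - 1) powr (\<rho> - 1) = 1 / (real N - 1) powr (1 - \<rho>)"
    using powr_minus_divide[of "real N - 1" "1 - \<rho>"] by simp
  finally show ?thesis by (simp add: powr_divide mult.commute)
qed

text \<open>Multiplied by \<open>k\<close>, the recursion reads
  \<open>k * v k \<le> (k - 1) * v (k - 1) + B / k\<close>, so the forcing adds up to a harmonic sum
  from \<open>N\<close> to \<open>n\<close>. Its first term \<open>1 / N\<close> is kept, and the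
  remaining ones are bounded by the logarithm.\<close>

lemma recursion_bound_eq_1:
  fixes v :: "nat \<Rightarrow> real" and N n :: nat
  assumes N: "N \<ge> 2" and v0: "0 \<le> v (N - 1)" and B: "0 \<le> B"
    and step: "\<And>k. k \<ge> N \<Longrightarrow> v k \<le> (1 - 1 / real k) * v (k - 1) + B / (real k)\<^sup>2"
    and n: "n \<ge> N"
  shows "v n \<le> v (N - 1) * (real N / (real n + 1)) + B * (1 / real N + ln (real n / real N)) / real n"
proof -
  have "v n \<le> v (N - 1) * ((real N - 1) / real n) + B * (1 / real N + ln (real n / real N)) / real n"
    using n
  proof (induction n rule: dec_induct)
    case base
    show ?case using step[of N] N by (simp add: field_simps power2_eq_square)
  next
    case (step j)
    let ?k = "real j + 1"
    have j: "real j > 0" "real N > 0" using step(1) N by auto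
    have "ln (real j / ?k) \<le> real j / ?k - 1" using j by (intro ln_le_minus_one) auto
    also have "\<dots> = - (1 / ?k)" by (simp add: field_simps)
    finally have "1 / ?k + ln (real j / real N) \<le> ln (?k / real N)"
      using j by (simp add: ln_div)
    then have L: "B * (1 / real N + ln (real j / real N)) + B * (1 / ?k)
        \<le> B * (1 / real N + ln (?k / real N))"
      using mult_left_mono[of "1 / ?k + ln (real j / real N)" "ln (?k / real N)" B] B
      by (simp add: distrib_left)
    have "v (Suc j) \<le> (1 - 1 / ?k) * v j + B / ?k\<^sup>2"
      using assms(4)[of "Suc j"] step(1) by (simp add: add.commute)
    also have "(1 - 1 / ?k) * v j \<le> (1 - 1 / ?k) *
        (v (N - 1) * ((real N - 1) / real j) + B * (1 / real N + ln (real j / real N)) / real j)"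
      using step(3) by (intro mult_left_mono) auto
    also have "\<dots> + B / ?k\<^sup>2 = v (N - 1) * ((real N - 1) / ?k)
        + (B * (1 / real N + ln (real j / real N)) + B * (1 / ?k)) / ?k"
    proof -
      have "(x / y) * (A * (Q / x) + B * L / x) + B / y\<^sup>2 = A * (Q / y) + (B * L + B * (1 / y)) / y"
        if "0 < x" "0 < y" for A Q L x y :: real
        using that by (simp add: field_simps power2_eq_square)
      moreover have "1 - 1 / ?k = real j / ?k" by (simp add: field_simps)
      ultimately show ?thesis using j(1) by simp
    qed
    also have "\<dots> \<le> v (N - 1) * ((real N - 1) / ?k) + B * (1 / real N + ln (?k / real N)) / ?k"
      using L by (intro add_left_mono divide_right_mono) auto
    finally show ?case by (simp add: add.commute)
  qed
  \<comment> \<open>After clearing denominators this says \<open>N - 1 \<le> n\<close>; it brings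
    the exact telescoped factor into the form shared by the three regimes.\<close>
  moreover have "(real N - 1) / real n \<le> real N / (real n + 1)"
    using n N by (simp add: field_simps)
  ultimately show ?thesis using mult_left_mono[OF _ v0] by fastforce
qed

text \<open>For \<open>\<rho> > 1\<close> the function \<open>B / ((\<rho> - 1) * k)\<close> is a
  supersolution of the recursion, so the noise decays like \<open>1 / k\<close> whatever the value
  of \<open>\<rho>\<close>. The bound \<open>\<rho> \<le> N\<close> keeps the factors
  \<open>1 - \<rho> / k\<close> nonnegative.\<close>

lemma recursion_bound_gt_1:
  fixes v :: "nat \<Rightarrow> real" and N n :: nat
  assumes N: "N \<ge> 2" and v0: "0 \<le> v (N - 1)" and B: "0 \<le> B" and \<rho>: "1 < \<rho>" "\<rho> \<le> real N"
    and step: "\<And>k. k \<ge> N \<Longrightarrow> v k \<le> (1 - \<rho> / real k) * v (k - 1) + B / (real k)\<^sup>2"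
    and n: "n \<ge> N"
  shows "v n \<le> v (N - 1) * (real N / (real n + 1)) powr \<rho> + B / ((\<rho> - 1) * real n)"
proof -
  have "v k \<le> v (N - 1) * (real N / (real k + 1)) powr \<rho> + B / ((\<rho> - 1) * real k)"
    if "k \<ge> N - 1" for k
    using that
  proof (induction k rule: dec_induct)
    case base
    show ?case using N B \<rho> by simp
  next
    case (step j)
    let ?k = "real j + 1"
    have k: "Suc j \<ge> N" "real j > 0" "\<rho> \<le> ?k" using step(1) N \<rho> by auto
    then have le: "\<rho> / ?k \<le> 1" by (simp add: field_simps)
    \<comment> \<open>The supersolution property; the slack is exactly
      \<open>1 / (j * (j + 1)\<^sup>2)\<close>.\<close>
    have S: "(1 - \<rho> / ?k) * (1 / ((\<rho> - 1) * real j)) + 1 / ?k\<^sup>2 \<le> 1 / ((\<rho> - 1) * ?k)"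
    proof -
      have "1 / ((\<rho> - 1) * ?k) - ((1 - \<rho> / ?k) * (1 / ((\<rho> - 1) * real j)) + 1 / ?k\<^sup>2)
          = 1 / (real j * ?k\<^sup>2)"
        using k \<rho> by (simp add: divide_simps) (simp add: algebra_simps power2_eq_square)
      moreover have "0 \<le> 1 / (real j * ?k\<^sup>2)" by simp
      ultimately show ?thesis by linarith
    qed
    have "v (Suc j) \<le> (1 - \<rho> / ?k) * v j + B / ?k\<^sup>2"
      using assms(6)[OF k(1)] by (simp add: add.commute)
    also have "\<dots> \<le> (1 - \<rho> / ?k) * (v (N - 1) * (real N / ?k) powr \<rho> + B / ((\<rho> - 1) * real j))
        + B / ?k\<^sup>2"
      using step(3) le by (intro add_right_mono mult_left_mono) auto
    also have "\<dots> = (1 - \<rho> / ?k) * (v (N - 1) * (real N / ?k) powr \<rho>)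
        + B * ((1 - \<rho> / ?k) * (1 / ((\<rho> - 1) * real j)) + 1 / ?k\<^sup>2)"
      by (simp add: distrib_left mult_ac)
    also have "\<dots> \<le> (?k / (?k + 1)) powr \<rho> * (v (N - 1) * (real N / ?k) powr \<rho>)
        + B * (1 / ((\<rho> - 1) * ?k))"
      using one_minus_le_powr[of ?k \<rho>] k \<rho> v0 B S
      by (intro add_mono mult_right_mono mult_left_mono) auto
    also have "(?k / (?k + 1)) powr \<rho> * (v (N - 1) * (real N / ?k) powr \<rho>)
        = v (N - 1) * (real N / (?k + 1)) powr \<rho>"
      using powr_ratio_mult[of ?k "?k + 1" "real N" \<rho>] k N by simp
    finally show ?case by (simp add: add.commute)
  qed
  then show ?thesis using n by simp
qed

subsection \<open>Contraction of the Lyapunov function\<close>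

text \<open>Here \<open>a\<close>, \<open>b\<close>, \<open>e\<close> are the expectations of \<open>\<parallel>D\<parallel>\<^sup>2\<close>, \<open>D \<bullet> m\<close>, \<open>\<parallel>m\<parallel>\<^sup>2\<close> before
  a step, where \<open>D = \<Theta> - \<theta>opt\<close>, and \<open>a'\<close>, \<open>b'\<close>, \<open>e'\<close> those after it; \<open>s\<close> and \<open>h\<close> are the
  expectations of \<open>D \<bullet> g \<Theta>\<close> and \<open>\<parallel>g \<Theta>\<parallel>\<^sup>2\<close>, and \<open>\<gamma>'\<close>, \<open>\<gamma>\<close> are the step sizes before and
  after.\<close>

lemma lyapunov_contraction:
  fixes a b e s h a' b' e' :: real
  assumes \<alpha>: "0 \<le> \<alpha>" "\<alpha> < 1" and J: "1 \<le> J" and c: "0 < c"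
    and \<gamma>: "0 < \<gamma>" "\<gamma> \<le> \<gamma>'"
    and nonneg: "0 \<le> e" "0 \<le> e'"
    and a': "a' = a + 2 * \<gamma> * (\<alpha> * b + (1 - \<alpha>) * s) + \<gamma>\<^sup>2 * e'"
    and b': "b' = \<alpha> * b + (1 - \<alpha>) * s + \<gamma> * e'"
    and e': "e' \<le> \<alpha> * e + (1 - \<alpha>) * ((J - 1 + \<alpha>) / J) * h + (1 - \<alpha>)\<^sup>2 * (C / J)"
    and s: "s \<le> - c * a" and h: "0 \<le> h" "c\<^sup>2 * h \<le> a" and C: "0 \<le> C"
    and \<gamma>1: "2 * (1 + \<alpha>) * c * \<gamma> \<le> 1 - \<alpha>"
    and \<gamma>2: "2 * (2 - \<alpha>) * (J - 1 + \<alpha>) * \<gamma> \<le> (1 - \<alpha>)\<^sup>2 * c ^ 3 * J"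
  shows "a' + (1 + \<alpha>) / (1 - \<alpha>) * \<gamma> * max b' 0 + 2 / (1 - \<alpha>)\<^sup>2 * \<gamma>\<^sup>2 * e'
    \<le> (1 - (1 - \<alpha>) * c * \<gamma>) * (a + (1 + \<alpha>) / (1 - \<alpha>) * \<gamma>' * max b 0
          + 2 / (1 - \<alpha>)\<^sup>2 * \<gamma>'\<^sup>2 * e)
      + 2 * (2 - \<alpha>) * (C / J) * \<gamma>\<^sup>2"
proof -
  define \<beta> where "\<beta> = 1 - \<alpha>"
  have \<alpha>\<beta>: "\<alpha> = 1 - \<beta>" "0 < \<beta>" "\<beta> \<le> 1" using \<alpha> by (auto simp: \<beta>_def)
  \<comment> \<open>The weights are forced. The value \<open>p\<close> solves
    \<open>(2 + p) * \<alpha> = p - \<beta>\<close>, so the old correlation returns with its own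
    weight less \<open>\<beta>\<close>. The value \<open>q\<close> then solves
    \<open>1 + p + q = q * (2 - \<alpha>)\<close>, so the old momentum returns with weight
    \<open>q * \<alpha> * (2 - \<alpha>) = q * (1 - \<beta>\<^sup>2)\<close>.\<close>
  define p where "p = (1 + \<alpha>) / \<beta>"
  define q where "q = 2 / \<beta>\<^sup>2"
  define b0 where "b0 = max b 0"
  have p: "1 \<le> p" "p * \<beta> = 2 - \<beta>" and q: "0 < q" "q * \<beta>\<^sup>2 = 2" and b0: "b \<le> b0" "0 \<le> b0"
    using \<alpha>\<beta> by (auto simp: p_def q_def b0_def)
  have a: "0 \<le> a" using h c by (meson mult_nonneg_nonneg order_trans zero_le_power2)
  have cg: "2 * c * \<gamma> \<le> 2 * (1 + \<alpha>) * c * \<gamma>"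
    using c \<gamma> \<alpha> by (simp add: mult_le_cancel_right)
  have cg': "2 * (c * \<gamma>) \<le> \<beta>" using cg \<gamma>1 by (simp add: \<beta>_def)
  have pq: "1 + p + q = q * (2 - \<alpha>)"
  proof -
    have "(1 + p + q) * \<beta>\<^sup>2 = \<beta>\<^sup>2 + p * \<beta> * \<beta> + q * \<beta>\<^sup>2" by (simp add: algebra_simps power2_eq_square)
    also have "\<dots> = (q * \<beta>\<^sup>2) * (2 - \<alpha>)"
      unfolding p q by (simp add: \<alpha>\<beta>(1) algebra_simps power2_eq_square)
    finally have "(1 + p + q) * \<beta>\<^sup>2 = (q * (2 - \<alpha>)) * \<beta>\<^sup>2" by (simp add: mult_ac)
    then show ?thesis using \<alpha>\<beta> by simp
  qed
  \<comment> \<open>A positive \<open>b'\<close> is replaced by its recursion, which raises the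
    coefficients of \<open>b\<close>, \<open>s\<close> and \<open>e'\<close>. Otherwise it
    contributes nothing, and the smaller coefficients are relaxed to the same bound because
    \<open>b0\<close> and \<open>e'\<close> are nonnegative.\<close>
  have main: "a' + p * \<gamma> * max b' 0 + q * \<gamma>\<^sup>2 * e'
      \<le> a - 2 * \<beta> * c * \<gamma> * a + (p - \<beta>) * \<gamma> * b0 + q * (2 - \<alpha>) * \<gamma>\<^sup>2 * e'"
  proof (cases "b' > 0")
    case True
    have "a' + p * \<gamma> * max b' 0 + q * \<gamma>\<^sup>2 * e'
       = a + ((2 + p) * \<alpha>) * \<gamma> * b + ((2 + p) * \<beta>) * \<gamma> * s + (1 + p + q) * \<gamma>\<^sup>2 * e'"
      using True by (simp add: a' b' \<beta>_def algebra_simps power2_eq_square)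
    also have "(2 + p) * \<alpha> = p - \<beta>" using p(2) by (simp add: \<alpha>\<beta>(1) algebra_simps)
    also have "(p - \<beta>) * \<gamma> * b \<le> (p - \<beta>) * \<gamma> * b0"
      using p(1) \<alpha>\<beta> \<gamma> b0 by (intro mult_left_mono) auto
    also have "(2 + p) * \<beta> = 2 + \<beta>" using p(2) by (simp add: algebra_simps)
    also have "(2 + \<beta>) * \<gamma> * s \<le> (2 + \<beta>) * \<gamma> * (- c * a)"
      using s \<gamma> \<alpha>\<beta> by (intro mult_left_mono) auto
    \<comment> \<open>Only \<open>2 * \<beta>\<close> is kept, the coefficient available when
      \<open>b'\<close> is not positive. One copy of \<open>\<beta> * c * \<gamma> * a\<close>
      becomes the contraction of \<open>a\<close>, the other pays for the gradient term in
      \<open>drift\<close>.\<close>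
    also have "\<dots> \<le> - (2 * \<beta> * c * \<gamma> * a)"
      using mult_right_mono[of "2 * \<beta>" "2 + \<beta>" "\<gamma> * (c * a)"] \<alpha>\<beta> \<gamma> c a
      by (simp add: mult_ac)
    finally show ?thesis using pq by (simp add: mult_ac)
  next
    case False
    have "a' + p * \<gamma> * max b' 0 + q * \<gamma>\<^sup>2 * e'
       = a + (2 * \<alpha>) * \<gamma> * b + (2 * \<beta>) * \<gamma> * s + (1 + q) * \<gamma>\<^sup>2 * e'"
      using False by (simp add: a' \<beta>_def algebra_simps max_def)
    also have "(2 * \<alpha>) * \<gamma> * b \<le> (2 * \<alpha>) * \<gamma> * b0"
      using \<alpha> \<gamma> b0 by (intro mult_left_mono) auto
    also have "\<dots> \<le> (p - \<beta>) * \<gamma> * b0"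
    proof -
      have "2 * \<alpha> \<le> (2 + p) * \<alpha>" using \<alpha> p by (intro mult_right_mono) auto
      also have "\<dots> = p - \<beta>" using p(2) by (simp add: \<alpha>\<beta>(1) algebra_simps)
      finally show ?thesis using \<gamma> b0 by (intro mult_right_mono) auto
    qed
    also have "(2 * \<beta>) * \<gamma> * s \<le> (2 * \<beta>) * \<gamma> * (- c * a)"
      using s \<gamma> \<alpha>\<beta> by (intro mult_left_mono) auto
    also have "(1 + q) * \<gamma>\<^sup>2 * e' \<le> (1 + p + q) * \<gamma>\<^sup>2 * e'"
      using p nonneg by (intro mult_right_mono) auto
    finally show ?thesis unfolding pq by (simp add: mult_ac)
  qed
  let ?H = "(J - 1 + \<alpha>) / J * h"
  \<comment> \<open>Nonnegativity of the contraction factor permits replacing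
    \<open>\<gamma>\<close> by the larger \<open>\<gamma>'\<close> in the old weights.\<close>
  have small: "0 \<le> 1 - \<beta> * c * \<gamma>"
  proof -
    have "\<beta> * (c * \<gamma>) \<le> 1 * (c * \<gamma>)" using \<alpha>\<beta> c \<gamma> by (intro mult_right_mono) auto
    then have "\<beta> * (c * \<gamma>) \<le> 1"
      using cg' \<alpha>\<beta> mult_pos_pos[OF c \<gamma>(1)] by linarith
    then show ?thesis by (simp add: mult_ac)
  qed
  have "q * (2 - \<alpha>) * \<gamma>\<^sup>2 * e' \<le> q * (2 - \<alpha>) * \<gamma>\<^sup>2 * (\<alpha> * e + \<beta> * ?H + \<beta>\<^sup>2 * (C / J))"
    using e' \<alpha> q by (intro mult_left_mono) (auto simp: \<beta>_def mult_ac)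
  also have "\<dots> = (\<alpha> * (2 - \<alpha>)) * (q * \<gamma>\<^sup>2 * e) + q * \<beta> * \<gamma> * ((2 - \<alpha>) * \<gamma> * ?H)
      + (q * \<beta>\<^sup>2) * (2 - \<alpha>) * (C / J) * \<gamma>\<^sup>2"
    by (simp add: algebra_simps power2_eq_square)
  finally have split: "q * (2 - \<alpha>) * \<gamma>\<^sup>2 * e' \<le> (\<alpha> * (2 - \<alpha>)) * (q * \<gamma>\<^sup>2 * e)
      + q * \<beta> * \<gamma> * ((2 - \<alpha>) * \<gamma> * ?H) + 2 * (2 - \<alpha>) * (C / J) * \<gamma>\<^sup>2"
    unfolding q(2) .
  \<comment> \<open>The second step-size condition is made for this: with
    \<open>c\<^sup>2 * h \<le> a\<close> and \<open>q * \<beta>\<^sup>2 = 2\<close>, the gradient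
    term fits into the spare copy of \<open>\<beta> * c * \<gamma> * a\<close>.\<close>
  have drift: "q * \<beta> * \<gamma> * ((2 - \<alpha>) * \<gamma> * ?H) \<le> \<beta> * c * \<gamma> * a"
  proof -
    have "2 * ((2 - \<alpha>) * \<gamma> * ((J - 1 + \<alpha>) / J)) \<le> \<beta>\<^sup>2 * c ^ 3"
      using \<gamma>2 J by (simp add: \<beta>_def field_simps)
    from mult_right_mono[OF this h(1)] have "2 * ((2 - \<alpha>) * \<gamma> * ?H) \<le> \<beta>\<^sup>2 * c * (c\<^sup>2 * h)"
      by (simp add: power2_eq_square power3_eq_cube mult_ac)
    also have "\<dots> \<le> \<beta>\<^sup>2 * c * a" using h c by (intro mult_left_mono) auto
    finally have "(2 - \<alpha>) * \<gamma> * ?H \<le> \<beta>\<^sup>2 * c * a / 2" by linarith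
    then have "q * \<beta> * \<gamma> * ((2 - \<alpha>) * \<gamma> * ?H) \<le> q * \<beta> * \<gamma> * (\<beta>\<^sup>2 * c * a / 2)"
      using q \<alpha>\<beta> \<gamma> by (intro mult_left_mono) auto
    also have "\<dots> = (q * \<beta>\<^sup>2) * (\<beta> * c * \<gamma> * a) / 2" by (simp add: mult_ac)
    finally show ?thesis using q by simp
  qed
  \<comment> \<open>Since \<open>\<alpha> * (2 - \<alpha>) = 1 - \<beta>\<^sup>2\<close>, the claim
    reduces to \<open>c * \<gamma> \<le> \<beta>\<close>.\<close>
  have "(\<alpha> * (2 - \<alpha>)) * (q * \<gamma>\<^sup>2 * e) \<le> (1 - \<beta> * c * \<gamma>) * (q * \<gamma>\<^sup>2 * e)"
  proof -
    have "c * \<gamma> \<le> \<beta>" using cg' mult_pos_pos[OF c \<gamma>(1)] by linarith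
    then have "\<beta> * (c * \<gamma>) \<le> \<beta> * \<beta>" using \<alpha>\<beta> by (intro mult_left_mono) auto
    then have "\<alpha> * (2 - \<alpha>) \<le> 1 - \<beta> * c * \<gamma>" by (simp add: \<alpha>\<beta>(1) algebra_simps)
    then show ?thesis using q nonneg by (intro mult_right_mono) auto
  qed
  also have "\<dots> \<le> (1 - \<beta> * c * \<gamma>) * (q * \<gamma>'\<^sup>2 * e)"
    using small q nonneg \<gamma> by (intro mult_left_mono mult_right_mono power_mono) auto
  finally have momentum: "(\<alpha> * (2 - \<alpha>)) * (q * \<gamma>\<^sup>2 * e) \<le> (1 - \<beta> * c * \<gamma>) * (q * \<gamma>'\<^sup>2 * e)" .
  \<comment> \<open>Equivalent for the weights to \<open>p * c * \<gamma> \<le> 1\<close>, that is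
    \<open>(1 + \<alpha>) * c * \<gamma> \<le> \<beta>\<close>; the first step-size condition leaves
    a factor 2 to spare.\<close>
  have "(p - \<beta>) * \<gamma> * b0 \<le> (1 - \<beta> * c * \<gamma>) * (p * \<gamma> * b0)"
  proof -
    have "0 \<le> (1 + \<alpha>) * (c * \<gamma>)" using c \<gamma> \<alpha> by simp
    moreover have "2 * (1 + \<alpha>) * c * \<gamma> = 2 * ((1 + \<alpha>) * (c * \<gamma>))" by simp
    ultimately have "(1 + \<alpha>) * (c * \<gamma>) \<le> \<beta>" using \<gamma>1 unfolding \<beta>_def by linarith
    then have "(p * \<beta>) * (c * \<gamma>) \<le> \<beta>" unfolding p by (simp add: \<alpha>\<beta>(1))
    then have "p - \<beta> \<le> (1 - \<beta> * c * \<gamma>) * p" by (simp add: algebra_simps)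
    then have "(p - \<beta>) * (\<gamma> * b0) \<le> (1 - \<beta> * c * \<gamma>) * p * (\<gamma> * b0)"
      using \<gamma> b0 by (intro mult_right_mono) auto
    then show ?thesis by (simp add: mult_ac)
  qed
  also have "\<dots> \<le> (1 - \<beta> * c * \<gamma>) * (p * \<gamma>' * b0)"
    using small p b0 \<gamma> by (intro mult_left_mono mult_right_mono) auto
  finally have "a' + p * \<gamma> * max b' 0 + q * \<gamma>\<^sup>2 * e'
      \<le> (1 - \<beta> * c * \<gamma>) * (a + p * \<gamma>' * b0 + q * \<gamma>'\<^sup>2 * e) + 2 * (2 - \<alpha>) * (C / J) * \<gamma>\<^sup>2"
    using main split drift momentum by (simp add: algebra_simps)
  then show ?thesis by (simp add: p_def q_def \<beta>_def b0_def)
qed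

subsection \<open>Independence of random variables with different value types\<close>

text \<open>On measurable rectangles the equality is independence itself, and rectangles determine a
  product of sigma-finite measures.\<close>

lemma (in prob_space) distr_pair_indep_set:
  assumes X[measurable]: "X \<in> measurable M S" and Y[measurable]: "Y \<in> measurable M T"
    and indep: "indep_set (sets (vimage_algebra (space M) X S)) (sets (vimage_algebra (space M) Y T))"
  shows "distr M (S \<Otimes>\<^sub>M T) (\<lambda>\<omega>. (X \<omega>, Y \<omega>)) = distr M S X \<Otimes>\<^sub>M distr M T Y"
proof (rule pair_measure_eqI[symmetric])
  show "sigma_finite_measure (distr M S X)" "sigma_finite_measure (distr M T Y)"
    by (auto intro!: prob_space_imp_sigma_finite prob_space_distr)
next
  fix A B assume "A \<in> sets (distr M S X)" "B \<in> sets (distr M T Y)"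
  then have [measurable]: "A \<in> sets S" "B \<in> sets T" by auto
  have "prob ((X -` A \<inter> space M) \<inter> (Y -` B \<inter> space M))
      = prob (X -` A \<inter> space M) * prob (Y -` B \<inter> space M)"
    by (intro indep_setD[OF indep] in_vimage_algebra) auto
  moreover have "(\<lambda>\<omega>. (X \<omega>, Y \<omega>)) -` (A \<times> B) \<inter> space M
      = (X -` A \<inter> space M) \<inter> (Y -` B \<inter> space M)" by auto
  ultimately show "emeasure (distr M S X) A * emeasure (distr M T Y) B
      = emeasure (distr M (S \<Otimes>\<^sub>M T) (\<lambda>\<omega>. (X \<omega>, Y \<omega>))) (A \<times> B)"
    by (simp add: emeasure_distr emeasure_eq_measure ennreal_mult'')
qed simp

text \<open>On generating rectangles,
  \<open>P(A B z) = P(A) P(B z) = P(A) P(B) P(z) = P(A B) P(z)\<close>: the first and last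
  equalities use that \<open>X\<close> is independent of \<open>\<W>\<close>, the middle one that
  \<open>Y\<close> and \<open>Z\<close> are independent. Stability of \<open>\<W>\<close> under
  intersection puts \<open>B z\<close> into \<open>\<W>\<close>.\<close>

lemma (in prob_space) indep_set_vimage_Pair:
  assumes X[measurable]: "X \<in> measurable M S" and Y[measurable]: "Y \<in> measurable M T"
    and Z[measurable]: "Z \<in> measurable M R"
    and YZ: "indep_set (sets (vimage_algebra (space M) Y T)) (sets (vimage_algebra (space M) Z R))"
    and W: "sets (vimage_algebra (space M) Y T) \<subseteq> \<W>" "sets (vimage_algebra (space M) Z R) \<subseteq> \<W>"
      "Int_stable \<W>"
    and XW: "indep_set (sets (vimage_algebra (space M) X S)) \<W>"
  shows "indep_set (sets (vimage_algebra (space M) (\<lambda>\<omega>. (X \<omega>, Y \<omega>)) (S \<Otimes>\<^sub>M T)))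
           (sets (vimage_algebra (space M) Z R))"
proof -
  let ?\<sigma> = "\<lambda>f N. sets (vimage_algebra (space M) f N)"
  let ?E = "{(X -` A \<inter> space M) \<inter> (Y -` B \<inter> space M) | A B. A \<in> sets S \<and> B \<in> sets T}"
  have XY: "(\<lambda>\<omega>. (X \<omega>, Y \<omega>)) \<in> space M \<rightarrow> space (S \<Otimes>\<^sub>M T)"
    using measurable_space[OF X] measurable_space[OF Y] by (auto simp: space_pair_measure)
  have E: "{(\<lambda>\<omega>. (X \<omega>, Y \<omega>)) -` C \<inter> space M | C. C \<in> {A \<times> B | A B. A \<in> sets S \<and> B \<in> sets T}} = ?E"
    (is "?L = ?E")
  proof -
    have *: "(\<lambda>\<omega>. (X \<omega>, Y \<omega>)) -` (A \<times> B) \<inter> space M = (X -` A \<inter> space M) \<inter> (Y -` B \<inter> space M)"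
      for A B by auto
    have "?L = {(\<lambda>\<omega>. (X \<omega>, Y \<omega>)) -` (A \<times> B) \<inter> space M | A B. A \<in> sets S \<and> B \<in> sets T}"
      by blast
    then show ?thesis unfolding * .
  qed
  have \<sigma>_pair: "?\<sigma> (\<lambda>\<omega>. (X \<omega>, Y \<omega>)) (S \<Otimes>\<^sub>M T) = sigma_sets (space M) ?E"
    unfolding sets_vimage_algebra2[OF XY] sets_pair_measure E[symmetric]
    by (rule sigma_sets_vimage_commute[OF XY[unfolded space_pair_measure]])
  have "indep_set (sigma_sets (space M) ?E) (sigma_sets (space M) (?\<sigma> Z R))"
  proof (rule indep_set_sigma_sets)
    show "Int_stable ?E"
    proof (rule Int_stableI)
      fix a b assume "a \<in> ?E" "b \<in> ?E"
      then obtain A B A' B' where "a = (X -` A \<inter> space M) \<inter> (Y -` B \<inter> space M)"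
          "b = (X -` A' \<inter> space M) \<inter> (Y -` B' \<inter> space M)"
          and "A \<in> sets S" "B \<in> sets T" "A' \<in> sets S" "B' \<in> sets T" by blast
      then have "a \<inter> b = (X -` (A \<inter> A') \<inter> space M) \<inter> (Y -` (B \<inter> B') \<inter> space M)"
          "A \<inter> A' \<in> sets S" "B \<inter> B' \<in> sets T" by auto
      then show "a \<inter> b \<in> ?E" by blast
    qed
    show "Int_stable (?\<sigma> Z R)" by (auto intro: Int_stableI)
    show "indep_set ?E (?\<sigma> Z R)"
    proof (rule indep_setI)
      show "?E \<subseteq> events" by (force intro: sets.Int measurable_sets[OF X] measurable_sets[OF Y])
      show "?\<sigma> Z R \<subseteq> events" using YZ by (rule indep_setD_ev2)
    next
      fix a z assume "a \<in> ?E" and z: "z \<in> ?\<sigma> Z R"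
      then obtain A B where a: "a = (X -` A \<inter> space M) \<inter> (Y -` B \<inter> space M)"
        and A: "A \<in> sets S" and B: "B \<in> sets T" by blast
      let ?A = "X -` A \<inter> space M" and ?B = "Y -` B \<inter> space M"
      have A': "?A \<in> ?\<sigma> X S" and B': "?B \<in> ?\<sigma> Y T"
        by (rule in_vimage_algebra[OF A], rule in_vimage_algebra[OF B])
      have "prob (?A \<inter> (?B \<inter> z)) = prob ?A * prob (?B \<inter> z)"
        using Int_stableD[OF W(3)] W(1,2) B' z by (intro indep_setD[OF XW A']) blast
      also have "prob (?B \<inter> z) = prob ?B * prob z" by (rule indep_setD[OF YZ B' z])
      also have "prob ?A * (prob ?B * prob z) = prob (?A \<inter> ?B) * prob z"
        using indep_setD[OF XW A', of ?B] W(1) B' by auto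
      finally show "prob (a \<inter> z) = prob a * prob z" by (simp add: a Int_assoc)
    qed
  qed
  moreover have "sigma_sets (space M) (?\<sigma> Z R) = ?\<sigma> Z R"
    using sets.sigma_sets_eq[of "vimage_algebra (space M) Z R"] by simp
  ultimately show ?thesis unfolding \<sigma>_pair by simp
qed

lemma (in prob_space) indep_set_vimage_subalgebra:
  assumes "space H = space M" "X \<in> measurable H S" "indep_set (sets H) B"
  shows "indep_set (sets (vimage_algebra (space M) X S)) B"
proof -
  have "sets (vimage_algebra (space M) X S) \<subseteq> sets H"
    using assms by (intro sets_image_in_sets) auto
  then show ?thesis using assms(3) unfolding indep_sets2_eq by blast
qed

text \<open>A freezing argument in place of conditional expectations: the law of
  \<open>((Y, X), Z)\<close> is a product, and Fubini integrates \<open>Z\<close> out while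
  \<open>X\<close> and \<open>Y\<close> stay fixed. Integrability of each section of
  \<open>G\<close> lets \<open>Y\<close> leave the inner integral.\<close>

lemma (in prob_space) integral_inner_indep:
  fixes X :: "'a \<Rightarrow> 'x::second_countable_topology" and Y :: "'a \<Rightarrow> 'y::euclidean_space"
    and Z :: "'a \<Rightarrow> 'z::second_countable_topology" and G :: "'x \<times> 'z \<Rightarrow> 'y"
  assumes H: "space H = space M" "indep_set (sets H) (sets (vimage_algebra (space M) Z borel))"
    and X: "X \<in> borel_measurable H" and Y: "Y \<in> borel_measurable H"
    and Z[measurable]: "Z \<in> borel_measurable M" and G[measurable]: "G \<in> borel_measurable (borel \<Otimes>\<^sub>M borel)"
    and int_G: "\<And>x. integrable (distr M borel Z) (\<lambda>z. G (x, z))"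
    and int: "integrable M (\<lambda>\<omega>. Y \<omega> \<bullet> G (X \<omega>, Z \<omega>))"
  shows "(\<integral>\<omega>. Y \<omega> \<bullet> G (X \<omega>, Z \<omega>) \<partial>M)
    = (\<integral>\<omega>. Y \<omega> \<bullet> (\<integral>z. G (X \<omega>, z) \<partial>distr M borel Z) \<partial>M)"
proof -
  have sub: "sets H \<subseteq> events" using H(2) by (rule indep_setD_ev1)
  have XY: "(\<lambda>\<omega>. (Y \<omega>, X \<omega>)) \<in> measurable H (borel \<Otimes>\<^sub>M borel)" using X Y by measurable
  have XY'[measurable]: "(\<lambda>\<omega>. (Y \<omega>, X \<omega>)) \<in> measurable M (borel \<Otimes>\<^sub>M borel)"
    using XY measurable_mono[OF order_refl refl sub H(1)] by blast
  let ?\<mu> = "distr M borel Z" and ?P = "distr M (borel \<Otimes>\<^sub>M borel) (\<lambda>\<omega>. (Y \<omega>, X \<omega>))"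
  let ?f = "\<lambda>p. fst (fst p) \<bullet> G (snd (fst p), snd p)"
  interpret \<mu>: prob_space ?\<mu> by (rule prob_space_distr) simp
  interpret P: prob_space ?P by (rule prob_space_distr) simp
  interpret pair_sigma_finite ?P ?\<mu> ..
  have law: "distr M ((borel \<Otimes>\<^sub>M borel) \<Otimes>\<^sub>M borel) (\<lambda>\<omega>. ((Y \<omega>, X \<omega>), Z \<omega>)) = ?P \<Otimes>\<^sub>M ?\<mu>"
    by (intro distr_pair_indep_set indep_set_vimage_subalgebra[OF H(1) XY H(2)]) simp_all
  have f[measurable]: "?f \<in> borel_measurable ((borel \<Otimes>\<^sub>M borel) \<Otimes>\<^sub>M borel)" by measurable
  have int_f: "integrable (?P \<Otimes>\<^sub>M ?\<mu>) ?f"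
    unfolding law[symmetric] using int by (subst integrable_distr_eq) simp_all
  have "(\<integral>\<omega>. Y \<omega> \<bullet> G (X \<omega>, Z \<omega>) \<partial>M) = integral\<^sup>L (?P \<Otimes>\<^sub>M ?\<mu>) ?f"
    unfolding law[symmetric] by (subst integral_distr) simp_all
  also have "\<dots> = (\<integral>p. (\<integral>z. ?f (p, z) \<partial>?\<mu>) \<partial>?P)"
    by (rule integral_fst'[OF int_f, symmetric])
  also have "\<dots> = (\<integral>p. fst p \<bullet> (\<integral>z. G (snd p, z) \<partial>?\<mu>) \<partial>?P)"
    by (intro Bochner_Integration.integral_cong refl) (simp add: int_G)
  also have "\<dots> = (\<integral>\<omega>. Y \<omega> \<bullet> (\<integral>z. G (X \<omega>, z) \<partial>?\<mu>) \<partial>M)"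
    by (subst integral_distr) simp_all
  finally show ?thesis .
qed

subsection \<open>Square-integrable random vectors\<close>

text \<open>Closure under sums and scalar multiples, together with integrability of inner products,
  settles integrability along the whole recursion by induction.\<close>

definition square_integrable :: "'a measure \<Rightarrow> ('a \<Rightarrow> 'v::euclidean_space) \<Rightarrow> bool" where
  "square_integrable M X \<longleftrightarrow> X \<in> borel_measurable M \<and> integrable M (\<lambda>\<omega>. (norm (X \<omega>))\<^sup>2)"

lemma square_integrable_inner:
  assumes "square_integrable M X" "square_integrable M Y"
  shows "integrable M (\<lambda>\<omega>. X \<omega> \<bullet> Y \<omega>)"
proof (rule Bochner_Integration.integrable_bound)
  show "integrable M (\<lambda>\<omega>. (norm (X \<omega>))\<^sup>2 + (norm (Y \<omega>))\<^sup>2)"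
    using assms by (auto simp: square_integrable_def)
  show "(\<lambda>\<omega>. X \<omega> \<bullet> Y \<omega>) \<in> borel_measurable M"
    using assms by (auto simp: square_integrable_def)
  show "AE \<omega> in M. norm (X \<omega> \<bullet> Y \<omega>) \<le> norm ((norm (X \<omega>))\<^sup>2 + (norm (Y \<omega>))\<^sup>2)"
  proof (rule AE_I2)
    fix \<omega>
    have "0 \<le> norm (X \<omega>) * norm (Y \<omega>)" by simp
    then show "norm (X \<omega> \<bullet> Y \<omega>) \<le> norm ((norm (X \<omega>))\<^sup>2 + (norm (Y \<omega>))\<^sup>2)"
      using Cauchy_Schwarz_ineq2[of "X \<omega>" "Y \<omega>"] sum_squares_bound[of "norm (X \<omega>)" "norm (Y \<omega>)"]
      by simp
  qed
qed

lemma square_integrable_add: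
  assumes "square_integrable M X" "square_integrable M Y"
  shows "square_integrable M (\<lambda>\<omega>. X \<omega> + Y \<omega>)"
proof -
  have "(norm (X \<omega> + Y \<omega>))\<^sup>2 = (norm (X \<omega>))\<^sup>2 + 2 * (X \<omega> \<bullet> Y \<omega>) + (norm (Y \<omega>))\<^sup>2" for \<omega>
    by (simp add: power2_norm_eq_inner inner_simps inner_commute)
  then show ?thesis
    using square_integrable_inner[OF assms] assms by (auto simp: square_integrable_def)
qed

lemma square_integrable_scaleR:
  "square_integrable M X \<Longrightarrow> square_integrable M (\<lambda>\<omega>. r *\<^sub>R X \<omega>)"
  by (auto simp: square_integrable_def power_mult_distrib)

lemma (in finite_measure) square_integrable_const: "square_integrable M (\<lambda>_. x)"
  by (simp add: square_integrable_def)

lemma (in finite_measure) square_integrable_diff_const: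
  "square_integrable M X \<Longrightarrow> square_integrable M (\<lambda>\<omega>. X \<omega> - x)"
  using square_integrable_add[OF _ square_integrable_const, of X "- x"] by simp

lemma (in finite_measure) square_integrable_sum:
  "finite I \<Longrightarrow> (\<And>i. i \<in> I \<Longrightarrow> square_integrable M (X i)) \<Longrightarrow>
    square_integrable M (\<lambda>\<omega>. \<Sum>i\<in>I. X i \<omega>)"
  by (induction I rule: finite_induct) (auto intro: square_integrable_add square_integrable_const)

lemma square_integrable_cong:
  "(\<And>\<omega>. \<omega> \<in> space M \<Longrightarrow> X \<omega> = Y \<omega>) \<Longrightarrow> square_integrable M X \<longleftrightarrow> square_integrable M Y"
  unfolding square_integrable_def
  by (intro arg_cong2[of _ _ _ _ "(\<and>)"] measurable_cong Bochner_Integration.integrable_cong) auto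

lemma sum_diagonal_off_diagonal:
  fixes f :: "nat \<Rightarrow> nat \<Rightarrow> real"
  assumes "\<And>i. i \<in> I \<Longrightarrow> f i i = p" "\<And>i j. i \<in> I \<Longrightarrow> j \<in> I \<Longrightarrow> i \<noteq> j \<Longrightarrow> f i j = q" "finite I"
  shows "(\<Sum>i\<in>I. \<Sum>j\<in>I. f i j) = real (card I) * p + real (card I) * (real (card I) - 1) * q"
proof -
  have "(\<Sum>j\<in>I. f i j) = p + (real (card I) - 1) * q" if "i \<in> I" for i
  proof -
    have "(\<Sum>j\<in>I. f i j) = f i i + (\<Sum>j\<in>I - {i}. f i j)"
      using that assms(3) by (rule sum.remove[rotated])
    also have "(\<Sum>j\<in>I - {i}. f i j) = (\<Sum>j\<in>I - {i}. q)"
      using that assms(2) by (intro sum.cong) auto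
    also have "\<dots> = (real (card I) - 1) * q"
      using that assms(3) by (subst card_Suc_Diff1[symmetric, of I i]) auto
    finally show ?thesis using assms(1) that by simp
  qed
  then have "(\<Sum>i\<in>I. \<Sum>j\<in>I. f i j) = (\<Sum>i\<in>I. p + (real (card I) - 1) * q)"
    by (rule sum.cong[OF refl])
  then show ?thesis by (simp add: algebra_simps)
qed

lemma norm_power2_combination:
  fixes x y :: "'v::real_inner"
  shows "(norm (r *\<^sub>R x + s *\<^sub>R y))\<^sup>2
    = r\<^sup>2 * (norm x)\<^sup>2 + 2 * r * s * (x \<bullet> y) + s\<^sup>2 * (norm y)\<^sup>2"
  unfolding power2_norm_eq_inner
  by (simp add: inner_add_left inner_add_right inner_commute power2_eq_square algebra_simps)

subsection \<open>Moments of momentum stochastic gradient descent\<close>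

text \<open>The step sizes remain an arbitrary real sequence: the moment recursions hold for any
  \<open>\<gamma>\<close>, and positivity and monotonicity enter only in
  \<open>lyapunov_step\<close>. The supremum bound appears in squared form.\<close>

locale momentum_sgd = prob_space M for M :: "'w measure" +
  fixes J :: nat
    and U :: "nat \<Rightarrow> nat \<Rightarrow> 'w \<Rightarrow> real ^ 'e"
    and G :: "(real ^ 'd) \<times> (real ^ 'e) \<Rightarrow> real ^ 'd"
    and \<alpha> :: real and \<nu> :: "real ^ 'd" and \<gamma> :: "nat \<Rightarrow> real"
    and \<Theta> m :: "nat \<Rightarrow> 'w \<Rightarrow> real ^ 'd"
    and \<cc> c :: real and \<theta>opt :: "real ^ 'd"
  assumes J: "J \<ge> 1"
    and iid: "iid_family M (\<lambda>(n, j). U n j) (UNIV \<times> {1..J})"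
    and G[measurable]: "G \<in> borel_measurable (borel \<Otimes>\<^sub>M borel)"
    and integrable_norm_G: "\<And>\<theta>. integrable M (\<lambda>\<omega>. norm (G (\<theta>, U 0 1 \<omega>)))"
    and \<alpha>: "0 \<le> \<alpha>" "\<alpha> < 1"
    and \<Theta>_0[measurable]: "\<Theta> 0 \<in> borel_measurable M"
    and m_0: "\<And>\<omega>. \<omega> \<in> space M \<Longrightarrow> m 0 \<omega> = \<nu>"
    and \<Theta>_Suc: "\<And>n \<omega>. \<omega> \<in> space M \<Longrightarrow> \<Theta> (Suc n) \<omega> = \<Theta> n \<omega> + \<gamma> (Suc n) *\<^sub>R m (Suc n) \<omega>"
    and m_Suc: "\<And>n \<omega>. \<omega> \<in> space M \<Longrightarrow> m (Suc n) \<omega> = \<alpha> *\<^sub>R m n \<omega>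
          + (1 - \<alpha>) *\<^sub>R ((1 / real J) *\<^sub>R (\<Sum>j = 1..J. G (\<Theta> n \<omega>, U (Suc n) j \<omega>)))"
    and indep_\<Theta>_0: "indep_of_sigma M (\<Theta> 0)
           (vimage_algebra (space M) (\<lambda>\<omega>. \<lambda>(n, j) \<in> UNIV \<times> {1..J}. U n j \<omega>)
             (Pi\<^sub>M (UNIV \<times> {1..J}) (\<lambda>_. borel)))"
    and square_integrable_\<Theta>_0: "integrable M (\<lambda>\<omega>. (norm (\<Theta> 0 \<omega>))\<^sup>2)"
    and integrable_G_\<Theta>: "\<And>n. integrable M (\<lambda>\<omega>. (norm (G (\<Theta> n \<omega>, U 0 1 \<omega>)))\<^sup>2)"
    and G_\<Theta>_le: "\<And>n. (\<integral>\<omega>. (norm (G (\<Theta> n \<omega>, U 0 1 \<omega>)))\<^sup>2 \<partial>M) \<le> \<cc>\<^sup>2"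
    and c: "c > 0"
    and descent: "\<And>\<theta>. (\<theta> - \<theta>opt) \<bullet> (\<integral>\<omega>. G (\<theta>, U 1 1 \<omega>) \<partial>M)
           \<le> - c * max ((norm (\<theta> - \<theta>opt))\<^sup>2) ((norm (\<integral>\<omega>. G (\<theta>, U 1 1 \<omega>) \<partial>M))\<^sup>2)"
begin

section \<open>Histories generated by the initial state and a set of noise variables\<close>

abbreviation idx :: "(nat \<times> nat) set" where "idx \<equiv> UNIV \<times> {1..J}"

definition noise :: "(nat \<times> nat) set \<Rightarrow> 'w \<Rightarrow> nat \<times> nat \<Rightarrow> real ^ 'e" where
  "noise A \<omega> = (\<lambda>(n, j)\<in>A. U n j \<omega>)"

definition hist :: "(nat \<times> nat) set \<Rightarrow> 'w measure" where
  "hist A = vimage_algebra (space M) (\<lambda>\<omega>. (\<Theta> 0 \<omega>, noise A \<omega>)) (borel \<Otimes>\<^sub>M Pi\<^sub>M A (\<lambda>_. borel))"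

text \<open>The sample \<open>U 1 1\<close> is the one in the descent condition; by identical
  distribution every sample of a minibatch has the same mean.\<close>

definition g :: "real ^ 'd \<Rightarrow> real ^ 'd" where
  "g \<theta> = (\<integral>\<omega>. G (\<theta>, U 1 1 \<omega>) \<partial>M)"

lemma indep_U: "indep_vars (\<lambda>_. borel) (\<lambda>(n, j). U n j) idx"
  using iid by (simp add: iid_family_def)

lemma measurable_U[measurable]: "j \<in> {1..J} \<Longrightarrow> U n j \<in> borel_measurable M"
  using indep_U by (auto simp: indep_vars_def)

lemma one_in_J[simp]: "Suc 0 \<in> {1..J}" "1 \<in> {1..J}"
  using J by auto

lemma measurable_U_1[measurable]: "U n (Suc 0) \<in> borel_measurable M" "U n 1 \<in> borel_measurable M"
  using measurable_U[of 1 n] J by auto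

lemma distr_U: "j \<in> {1..J} \<Longrightarrow> distr M borel (U n j) = distr M borel (U 0 1)"
  using iid J unfolding iid_family_def by fastforce

lemma measurable_noise[measurable]:
  assumes "A \<subseteq> idx"
  shows "noise A \<in> measurable M (Pi\<^sub>M A (\<lambda>_. borel))"
  unfolding noise_def using assms
  by (intro measurable_restrict) (auto simp: split_beta intro!: measurable_U)

lemma noise_range: "noise A \<omega> \<in> space (Pi\<^sub>M A (\<lambda>_. borel))"
  by (auto simp: noise_def space_PiM)

lemma space_hist[simp]: "space (hist A) = space M"
  by (simp add: hist_def)

lemma measurable_hist:
  shows \<Theta>_0_measurable_hist: "\<Theta> 0 \<in> borel_measurable (hist A)"
    and U_measurable_hist: "(n, j) \<in> A \<Longrightarrow> U n j \<in> borel_measurable (hist A)"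
proof -
  have *[measurable]: "(\<lambda>\<omega>. (\<Theta> 0 \<omega>, noise A \<omega>)) \<in> measurable (hist A) (borel \<Otimes>\<^sub>M Pi\<^sub>M A (\<lambda>_. borel))"
    unfolding hist_def
    by (rule measurable_vimage_algebra1) (auto simp: space_pair_measure noise_range)
  have "(\<lambda>\<omega>. fst (\<Theta> 0 \<omega>, noise A \<omega>)) \<in> borel_measurable (hist A)"
    using measurable_compose[OF * measurable_fst] .
  then show "\<Theta> 0 \<in> borel_measurable (hist A)" by simp
  assume nj: "(n, j) \<in> A"
  have "(\<lambda>\<omega>. snd (\<Theta> 0 \<omega>, noise A \<omega>) (n, j)) \<in> borel_measurable (hist A)"
    using measurable_compose[OF measurable_compose[OF * measurable_snd]
        measurable_component_singleton[OF nj]] .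
  then show "U n j \<in> borel_measurable (hist A)" using nj by (simp add: noise_def)
qed

text \<open>Disjoint index sets make \<open>noise A\<close> and \<open>U n j\<close> independent.
  Both are measurable with respect to the whole noise, of which \<open>\<Theta> 0\<close> is
  independent, so \<open>\<Theta> 0\<close> can be added to the history.\<close>

lemma indep_hist:
  assumes A: "A \<subseteq> idx" and j: "j \<in> {1..J}" and nj: "(n, j) \<notin> A"
  shows "indep_set (sets (hist A)) (sets (vimage_algebra (space M) (U n j) borel))"
proof -
  let ?\<sigma> = "\<lambda>f N. sets (vimage_algebra (space M) f N)"
  let ?W = "vimage_algebra (space M) (noise idx) (Pi\<^sub>M idx (\<lambda>_. borel))"
  have "indep_var (Pi\<^sub>M A (\<lambda>_. borel)) (noise A) (Pi\<^sub>M {(n, j)} (\<lambda>_. borel)) (noise {(n, j)})"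
    unfolding noise_def
    using indep_var_restrict[OF indep_U, of A "{(n, j)}"] A j nj
    by (simp add: split_beta' restrict_def)
  then have "indep_set (?\<sigma> (noise A) (Pi\<^sub>M A (\<lambda>_. borel)))
      (?\<sigma> (noise {(n, j)}) (Pi\<^sub>M {(n, j)} (\<lambda>_. borel)))"
    unfolding indep_var_eq sets_vimage_algebra by blast
  moreover have "?\<sigma> (U n j) borel \<subseteq> ?\<sigma> (noise {(n, j)}) (Pi\<^sub>M {(n, j)} (\<lambda>_. borel))"
  proof (rule sets_image_in_sets)
    have "noise {(n, j)} \<in> measurable (vimage_algebra (space M) (noise {(n, j)}) (Pi\<^sub>M {(n, j)} (\<lambda>_. borel)))
        (Pi\<^sub>M {(n, j)} (\<lambda>_. borel))"
      by (rule measurable_vimage_algebra1) (auto intro: noise_range)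
    from measurable_compose[OF this measurable_component_singleton[of "(n, j)"]]
    show "U n j \<in> borel_measurable (vimage_algebra (space M) (noise {(n, j)}) (Pi\<^sub>M {(n, j)} (\<lambda>_. borel)))"
      by (simp add: noise_def)
  qed simp
  ultimately have YZ: "indep_set (?\<sigma> (noise A) (Pi\<^sub>M A (\<lambda>_. borel))) (?\<sigma> (U n j) borel)"
    unfolding indep_sets2_eq by blast
  have noise_W: "noise idx \<in> measurable ?W (Pi\<^sub>M idx (\<lambda>_. borel))"
    by (rule measurable_vimage_algebra1) (auto intro: noise_range)
  have U_W: "U k i \<in> borel_measurable ?W" if "(k, i) \<in> idx" for k i
    using measurable_compose[OF noise_W measurable_component_singleton[OF that]] that
    by (simp add: noise_def)
  show ?thesis unfolding hist_def
  proof (rule indep_set_vimage_Pair[OF \<Theta>_0 measurable_noise[OF A] measurable_U[OF j] YZ])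
    show "?\<sigma> (noise A) (Pi\<^sub>M A (\<lambda>_. borel)) \<subseteq> sets ?W"
    proof (rule sets_image_in_sets)
      show "noise A \<in> measurable ?W (Pi\<^sub>M A (\<lambda>_. borel))"
        unfolding noise_def using A
        by (intro measurable_restrict) (auto simp: split_beta simp flip: noise_def intro!: U_W[simplified])
    qed simp
    show "?\<sigma> (U n j) borel \<subseteq> sets ?W"
      using U_W j by (intro sets_image_in_sets) auto
    show "Int_stable (sets ?W)" by (auto intro: Int_stableI)
    show "indep_set (?\<sigma> (\<Theta> 0) borel) (sets ?W)"
      using indep_\<Theta>_0 unfolding indep_of_sigma_def noise_def by simp
  qed
qed

text \<open>The indices start at 1 since \<open>\<Theta> 0\<close> generates part of the history and
  \<open>m 0\<close> is constant. Keeping \<open>A\<close> general covers both \<open>past n\<close>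
  and \<open>past n\<close> enlarged by a sample of the next step.\<close>

lemma adapted:
  assumes "\<And>k j. 1 \<le> k \<Longrightarrow> k \<le> n \<Longrightarrow> j \<in> {1..J} \<Longrightarrow> (k, j) \<in> A"
  shows "\<Theta> n \<in> borel_measurable (hist A) \<and> m n \<in> borel_measurable (hist A)"
  using assms
proof (induction n)
  case 0
  have "m 0 \<in> borel_measurable (hist A) \<longleftrightarrow> (\<lambda>_. \<nu>) \<in> borel_measurable (hist A)"
    by (rule measurable_cong) (simp add: m_0)
  then show ?case by (simp add: \<Theta>_0_measurable_hist)
next
  case (Suc n)
  then have [measurable]: "\<Theta> n \<in> borel_measurable (hist A)" "m n \<in> borel_measurable (hist A)"
    by auto
  have [measurable]: "U (Suc n) j \<in> borel_measurable (hist A)" if "j \<in> {1..J}" for j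
    using Suc.prems that by (intro U_measurable_hist) auto
  have "m (Suc n) \<in> borel_measurable (hist A) \<longleftrightarrow> (\<lambda>\<omega>. \<alpha> *\<^sub>R m n \<omega>
      + (1 - \<alpha>) *\<^sub>R ((1 / real J) *\<^sub>R (\<Sum>j = 1..J. G (\<Theta> n \<omega>, U (Suc n) j \<omega>))))
        \<in> borel_measurable (hist A)"
    by (rule measurable_cong) (simp add: m_Suc)
  also have "\<dots>" by measurable
  finally have [measurable]: "m (Suc n) \<in> borel_measurable (hist A)" .
  have "\<Theta> (Suc n) \<in> borel_measurable (hist A) \<longleftrightarrow>
      (\<lambda>\<omega>. \<Theta> n \<omega> + \<gamma> (Suc n) *\<^sub>R m (Suc n) \<omega>) \<in> borel_measurable (hist A)"
    by (rule measurable_cong) (simp add: \<Theta>_Suc)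
  also have "\<dots>" by measurable
  finally show ?case by simp
qed

text \<open>The indices start at 1, so \<open>U 0 1\<close> is a fresh copy of the noise for every \<open>n\<close>.\<close>

definition past :: "nat \<Rightarrow> (nat \<times> nat) set" where
  "past n = {1..n} \<times> {1..J}"

lemma past_subset: "past n \<subseteq> idx"
  by (auto simp: past_def)

lemma adapted_past:
  "\<Theta> n \<in> borel_measurable (hist (past n))" "m n \<in> borel_measurable (hist (past n))"
  using adapted[of n "past n"] by (auto simp: past_def)

lemma measurable_hist_events:
  assumes "A \<subseteq> idx" "X \<in> measurable (hist A) N"
  shows "X \<in> measurable M N"
proof -
  have "(\<lambda>\<omega>. (\<Theta> 0 \<omega>, noise A \<omega>)) \<in> measurable M (borel \<Otimes>\<^sub>M Pi\<^sub>M A (\<lambda>_. borel))"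
    using assms(1) by measurable
  then have "sets (hist A) \<subseteq> events"
    unfolding hist_def by (intro sets_image_in_sets) auto
  then show ?thesis
    using measurable_mono[OF order_refl refl, of "hist A" M] assms(2) by auto
qed

lemma measurable_\<Theta>[measurable]: "\<Theta> n \<in> borel_measurable M"
  and measurable_m[measurable]: "m n \<in> borel_measurable M"
  by (rule measurable_hist_events[OF past_subset[of n]], rule adapted_past)+

section \<open>The mean field and the law of a fresh sample\<close>

lemma integrable_G:
  assumes "j \<in> {1..J}"
  shows "integrable (distr M borel (U n j)) (\<lambda>u. G (\<theta>, u))"
proof -
  have "integrable M (\<lambda>\<omega>. G (\<theta>, U 0 1 \<omega>))"
    using integrable_norm_G[of \<theta>] by (subst (asm) integrable_norm_iff) auto
  then show ?thesis unfolding distr_U[OF assms] by (subst integrable_distr_eq) auto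
qed

lemma g_eq:
  assumes "j \<in> {1..J}"
  shows "(\<integral>u. G (\<theta>, u) \<partial>distr M borel (U n j)) = g \<theta>"
  unfolding distr_U[OF assms] distr_U[OF one_in_J(2), of 1, symmetric] g_def
  by (subst integral_distr) auto

lemma measurable_g[measurable]: "g \<in> borel_measurable borel"
proof -
  interpret \<mu>: prob_space "distr M borel (U 0 1)" by (rule prob_space_distr) simp
  have "(\<lambda>\<theta>. \<integral>u. G (\<theta>, u) \<partial>distr M borel (U 0 1)) \<in> borel_measurable borel"
    by measurable
  also have "(\<lambda>\<theta>. \<integral>u. G (\<theta>, u) \<partial>distr M borel (U 0 1)) = g"
    by (intro ext g_eq one_in_J)
  finally show ?thesis .
qed

text \<open>The second entry of the maximum and Cauchy-Schwarz give \<open>c * (norm (g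
  \<theta>))\<^sup>2 \<le> norm (\<theta> - \<theta>opt) * norm (g \<theta>)\<close>. This linear
  growth makes \<open>g (\<Theta> n)\<close> square-integrable and supplies the bound on
  \<open>h\<close> in the contraction.\<close>

lemma norm_g_le: "c * norm (g \<theta>) \<le> norm (\<theta> - \<theta>opt)"
proof -
  have "c * (norm (g \<theta>))\<^sup>2 \<le> - ((\<theta> - \<theta>opt) \<bullet> g \<theta>)"
    using descent[of \<theta>] mult_left_mono[OF max.cobounded2, of c "(norm (g \<theta>))\<^sup>2" "(norm (\<theta> - \<theta>opt))\<^sup>2"] c
    unfolding g_def by linarith
  also have "\<dots> \<le> norm (\<theta> - \<theta>opt) * norm (g \<theta>)"
    using Cauchy_Schwarz_ineq2[of "\<theta> - \<theta>opt" "g \<theta>"] by linarith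
  finally have "(c * norm (g \<theta>)) * norm (g \<theta>) \<le> norm (\<theta> - \<theta>opt) * norm (g \<theta>)"
    by (simp add: power2_eq_square mult_ac)
  then show ?thesis by (cases "g \<theta> = 0") (auto simp: mult_le_cancel_right)
qed

lemma inner_g_le: "(\<theta> - \<theta>opt) \<bullet> g \<theta> \<le> - c * (norm (\<theta> - \<theta>opt))\<^sup>2"
  using descent[of \<theta>] mult_left_mono[OF max.cobounded1, of c "(norm (\<theta> - \<theta>opt))\<^sup>2" "(norm (g \<theta>))\<^sup>2"] c
  unfolding g_def by linarith

text \<open>The right side depends on neither \<open>k\<close> nor \<open>j\<close>, so the moment
  bound assumed for \<open>U 0 1\<close> carries over to every sample of a later step.\<close>

lemma law_\<Theta>_U:
  assumes "j \<in> {1..J}" "(k, j) \<notin> past n"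
  shows "distr M (borel \<Otimes>\<^sub>M borel) (\<lambda>\<omega>. (\<Theta> n \<omega>, U k j \<omega>))
    = distr M borel (\<Theta> n) \<Otimes>\<^sub>M distr M borel (U 0 1)"
  unfolding distr_U[OF assms(1), of k, symmetric] using assms
  by (intro distr_pair_indep_set indep_set_vimage_subalgebra[OF space_hist adapted_past(1)]
      indep_hist past_subset) auto

lemma G_\<Theta>_U:
  assumes "j \<in> {1..J}" "k > n"
  shows square_integrable_G_\<Theta>: "square_integrable M (\<lambda>\<omega>. G (\<Theta> n \<omega>, U k j \<omega>))"
    and second_moment_G_\<Theta>: "(\<integral>\<omega>. (norm (G (\<Theta> n \<omega>, U k j \<omega>)))\<^sup>2 \<partial>M) \<le> \<cc>\<^sup>2"
proof -
  let ?L = "\<lambda>k j. distr M (borel \<Otimes>\<^sub>M borel) (\<lambda>\<omega>. (\<Theta> n \<omega>, U k j \<omega>))"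
  have [measurable]: "U k j \<in> borel_measurable M" using assms by simp
  have eq: "?L k j = ?L 0 1"
    using law_\<Theta>_U[of j k n] law_\<Theta>_U[of 1 0 n] assms by (simp add: past_def)
  have "integrable (?L 0 1) (\<lambda>p. (norm (G p))\<^sup>2)"
    using integrable_G_\<Theta>[of n] by (subst integrable_distr_eq) auto
  then have "integrable M (\<lambda>\<omega>. (norm (G (\<Theta> n \<omega>, U k j \<omega>)))\<^sup>2)"
    unfolding eq[symmetric] by (subst (asm) integrable_distr_eq) auto
  then show "square_integrable M (\<lambda>\<omega>. G (\<Theta> n \<omega>, U k j \<omega>))"
    by (simp add: square_integrable_def)
  have "(\<integral>\<omega>. (norm (G (\<Theta> n \<omega>, U k j \<omega>)))\<^sup>2 \<partial>M) = (\<integral>p. (norm (G p))\<^sup>2 \<partial>?L k j)"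
    by (subst integral_distr) auto
  also have "\<dots> = (\<integral>\<omega>. (norm (G (\<Theta> n \<omega>, U 0 1 \<omega>)))\<^sup>2 \<partial>M)"
    unfolding eq by (subst integral_distr) auto
  finally show "(\<integral>\<omega>. (norm (G (\<Theta> n \<omega>, U k j \<omega>)))\<^sup>2 \<partial>M) \<le> \<cc>\<^sup>2"
    using G_\<Theta>_le[of n] by simp
qed

section \<open>Minibatch averages\<close>

definition minibatch :: "nat \<Rightarrow> 'w \<Rightarrow> real ^ 'd" where
  "minibatch n \<omega> = (1 / real J) *\<^sub>R (\<Sum>j = 1..J. G (\<Theta> n \<omega>, U (Suc n) j \<omega>))"

lemma square_integrable_minibatch: "square_integrable M (minibatch n)"
  unfolding minibatch_def
  by (intro square_integrable_scaleR square_integrable_sum square_integrable_G_\<Theta>) auto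

lemma square_integrable_m: "square_integrable M (m n)"
proof (induction n)
  case 0
  show ?case using square_integrable_cong[of M "m 0" "\<lambda>_. \<nu>"] by (simp add: m_0 square_integrable_const)
next
  case (Suc n)
  have "square_integrable M (\<lambda>\<omega>. \<alpha> *\<^sub>R m n \<omega> + (1 - \<alpha>) *\<^sub>R minibatch n \<omega>)"
    by (intro square_integrable_add square_integrable_scaleR Suc square_integrable_minibatch)
  then show ?case
    using square_integrable_cong[of M "m (Suc n)"] by (simp add: m_Suc minibatch_def)
qed

lemma square_integrable_\<Theta>: "square_integrable M (\<Theta> n)"
proof (induction n)
  case 0
  show ?case using square_integrable_\<Theta>_0 by (simp add: square_integrable_def)
next
  case (Suc n)
  have "square_integrable M (\<lambda>\<omega>. \<Theta> n \<omega> + \<gamma> (Suc n) *\<^sub>R m (Suc n) \<omega>)"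
    by (intro square_integrable_add square_integrable_scaleR Suc square_integrable_m)
  then show ?case
    using square_integrable_cong[of M "\<Theta> (Suc n)"] by (simp add: \<Theta>_Suc)
qed

lemma square_integrable_error: "square_integrable M (\<lambda>\<omega>. \<Theta> n \<omega> - \<theta>opt)"
  by (intro square_integrable_diff_const square_integrable_\<Theta>)

lemma g_\<Theta>:
  shows square_integrable_g: "square_integrable M (\<lambda>\<omega>. g (\<Theta> n \<omega>))"
    and second_moment_g: "c\<^sup>2 * (\<integral>\<omega>. (norm (g (\<Theta> n \<omega>)))\<^sup>2 \<partial>M) \<le> (\<integral>\<omega>. (norm (\<Theta> n \<omega> - \<theta>opt))\<^sup>2 \<partial>M)"
proof -
  have le: "c\<^sup>2 * (norm (g \<theta>))\<^sup>2 \<le> (norm (\<theta> - \<theta>opt))\<^sup>2" for \<theta>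
    using power_mono[OF norm_g_le[of \<theta>], of 2] c by (simp add: power_mult_distrib)
  have int: "integrable M (\<lambda>\<omega>. (norm (\<Theta> n \<omega> - \<theta>opt))\<^sup>2)"
    using square_integrable_error by (simp add: square_integrable_def)
  then have "integrable M (\<lambda>\<omega>. c\<^sup>2 * (norm (g (\<Theta> n \<omega>)))\<^sup>2)"
    by (rule Bochner_Integration.integrable_bound) (use le in \<open>auto\<close>)
  then have int_g: "integrable M (\<lambda>\<omega>. (norm (g (\<Theta> n \<omega>)))\<^sup>2)"
    using c by simp
  then show "square_integrable M (\<lambda>\<omega>. g (\<Theta> n \<omega>))" by (simp add: square_integrable_def)
  have "(\<integral>\<omega>. c\<^sup>2 * (norm (g (\<Theta> n \<omega>)))\<^sup>2 \<partial>M) \<le> (\<integral>\<omega>. (norm (\<Theta> n \<omega> - \<theta>opt))\<^sup>2 \<partial>M)"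
    using int int_g le by (intro integral_mono) auto
  then show "c\<^sup>2 * (\<integral>\<omega>. (norm (g (\<Theta> n \<omega>)))\<^sup>2 \<partial>M) \<le> (\<integral>\<omega>. (norm (\<Theta> n \<omega> - \<theta>opt))\<^sup>2 \<partial>M)"
    by simp
qed

text \<open>Averaging over one fresh sample. As \<open>A\<close> may exceed \<open>past n\<close>,
  the factor \<open>Y\<close> may itself involve other samples of the same step.\<close>

lemma integral_inner_G:
  assumes A: "past n \<subseteq> A" "A \<subseteq> idx" "(k, j) \<notin> A" and j: "j \<in> {1..J}" and k: "k > n"
    and Y: "Y \<in> borel_measurable (hist A)" "square_integrable M Y"
  shows "(\<integral>\<omega>. Y \<omega> \<bullet> G (\<Theta> n \<omega>, U k j \<omega>) \<partial>M) = (\<integral>\<omega>. Y \<omega> \<bullet> g (\<Theta> n \<omega>) \<partial>M)"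
proof -
  have "(\<integral>\<omega>. Y \<omega> \<bullet> G (\<Theta> n \<omega>, U k j \<omega>) \<partial>M)
      = (\<integral>\<omega>. Y \<omega> \<bullet> (\<integral>u. G (\<Theta> n \<omega>, u) \<partial>distr M borel (U k j)) \<partial>M)"
  proof (rule integral_inner_indep[OF space_hist indep_hist[OF A(2) j A(3)] _ Y(1)])
    show "\<Theta> n \<in> borel_measurable (hist A)"
      using adapted[of n A] A(1) by (auto simp: past_def subset_iff)
    show "integrable M (\<lambda>\<omega>. Y \<omega> \<bullet> G (\<Theta> n \<omega>, U k j \<omega>))"
      using Y(2) square_integrable_G_\<Theta>[OF j k] by (rule square_integrable_inner)
  qed (use j integrable_G in \<open>auto\<close>)
  then show ?thesis by (simp add: g_eq[OF j])
qed

lemma integral_inner_minibatch: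
  assumes Y: "Y \<in> borel_measurable (hist (past n))" "square_integrable M Y"
  shows "(\<integral>\<omega>. Y \<omega> \<bullet> minibatch n \<omega> \<partial>M) = (\<integral>\<omega>. Y \<omega> \<bullet> g (\<Theta> n \<omega>) \<partial>M)"
proof -
  have "(\<integral>\<omega>. Y \<omega> \<bullet> minibatch n \<omega> \<partial>M)
      = (\<integral>\<omega>. (1 / real J) * (\<Sum>j = 1..J. Y \<omega> \<bullet> G (\<Theta> n \<omega>, U (Suc n) j \<omega>)) \<partial>M)"
    by (simp add: minibatch_def inner_sum_right)
  also have "\<dots> = (1 / real J) * (\<Sum>j = 1..J. \<integral>\<omega>. Y \<omega> \<bullet> G (\<Theta> n \<omega>, U (Suc n) j \<omega>) \<partial>M)"
    by (subst integral_mult_right_zero, subst Bochner_Integration.integral_sum)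
      (auto intro!: square_integrable_inner[OF Y(2)] square_integrable_G_\<Theta>)
  also have "\<dots> = (1 / real J) * (\<Sum>j = 1..J. \<integral>\<omega>. Y \<omega> \<bullet> g (\<Theta> n \<omega>) \<partial>M)"
    by (intro arg_cong[where f = "(*) (1 / real J)"] sum.cong refl
        integral_inner_G[OF order_refl past_subset _ _ _ Y]) (auto simp: past_def)
  also have "\<dots> = (\<integral>\<omega>. Y \<omega> \<bullet> g (\<Theta> n \<omega>) \<partial>M)" using J by simp
  finally show ?thesis .
qed

text \<open>The samples are averaged one at a time: sample \<open>j\<close> with sample
  \<open>i\<close> counted into the history, then sample \<open>i\<close> with only the past
  known.\<close>

lemma integral_inner_G_G:
  assumes ij: "i \<in> {1..J}" "j \<in> {1..J}" "i \<noteq> j"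
  shows "(\<integral>\<omega>. G (\<Theta> n \<omega>, U (Suc n) i \<omega>) \<bullet> G (\<Theta> n \<omega>, U (Suc n) j \<omega>) \<partial>M)
    = (\<integral>\<omega>. (norm (g (\<Theta> n \<omega>)))\<^sup>2 \<partial>M)"
proof -
  let ?A = "insert (Suc n, i) (past n)"
  have [measurable]: "\<Theta> n \<in> borel_measurable (hist ?A)" "U (Suc n) i \<in> borel_measurable (hist ?A)"
    using adapted[of n ?A] by (auto simp: past_def intro: U_measurable_hist)
  have X: "(\<lambda>\<omega>. G (\<Theta> n \<omega>, U (Suc n) i \<omega>)) \<in> borel_measurable (hist ?A)" by measurable
  have "(\<integral>\<omega>. G (\<Theta> n \<omega>, U (Suc n) i \<omega>) \<bullet> G (\<Theta> n \<omega>, U (Suc n) j \<omega>) \<partial>M)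
      = (\<integral>\<omega>. G (\<Theta> n \<omega>, U (Suc n) i \<omega>) \<bullet> g (\<Theta> n \<omega>) \<partial>M)"
    by (rule integral_inner_G[OF _ _ _ _ _ X square_integrable_G_\<Theta>]) (use ij in \<open>auto simp: past_def\<close>)
  also have "\<dots> = (\<integral>\<omega>. g (\<Theta> n \<omega>) \<bullet> G (\<Theta> n \<omega>, U (Suc n) i \<omega>) \<partial>M)"
    by (simp add: inner_commute)
  also have "\<dots> = (\<integral>\<omega>. g (\<Theta> n \<omega>) \<bullet> g (\<Theta> n \<omega>) \<partial>M)"
    using ij measurable_compose[OF adapted_past(1) measurable_g]
    by (intro integral_inner_G[OF order_refl past_subset] square_integrable_g) (auto simp: past_def)
  finally show ?thesis by (simp add: power2_norm_eq_inner)
qed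

text \<open>In the expanded square the \<open>J\<close> diagonal terms are at most
  \<open>\<cc>\<^sup>2\<close>, and each of the \<open>J * (J - 1)\<close> others equals the second
  moment of \<open>g (\<Theta> n)\<close>. Division by \<open>J\<^sup>2\<close> produces the gain
  \<open>1 / J\<close> of the final rates.\<close>

lemma second_moment_minibatch:
  "(\<integral>\<omega>. (norm (minibatch n \<omega>))\<^sup>2 \<partial>M)
    \<le> \<cc>\<^sup>2 / real J + (real J - 1) / real J * (\<integral>\<omega>. (norm (g (\<Theta> n \<omega>)))\<^sup>2 \<partial>M)"
proof -
  let ?X = "\<lambda>j \<omega>. G (\<Theta> n \<omega>, U (Suc n) j \<omega>)"
  let ?h = "\<integral>\<omega>. (norm (g (\<Theta> n \<omega>)))\<^sup>2 \<partial>M"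
  have int: "integrable M (\<lambda>\<omega>. ?X i \<omega> \<bullet> ?X j \<omega>)" if "i \<in> {1..J}" "j \<in> {1..J}" for i j
    using that by (intro square_integrable_inner square_integrable_G_\<Theta>) auto
  have "(\<integral>\<omega>. (norm (minibatch n \<omega>))\<^sup>2 \<partial>M)
      = (\<integral>\<omega>. (1 / real J)\<^sup>2 * (\<Sum>i = 1..J. \<Sum>j = 1..J. ?X i \<omega> \<bullet> ?X j \<omega>) \<partial>M)"
  proof (intro Bochner_Integration.integral_cong refl)
    fix \<omega>
    have "(norm (minibatch n \<omega>))\<^sup>2 = (1 / real J)\<^sup>2 * (norm (\<Sum>j = 1..J. ?X j \<omega>))\<^sup>2"
      by (simp add: minibatch_def power_divide)
    then show "(norm (minibatch n \<omega>))\<^sup>2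
        = (1 / real J)\<^sup>2 * (\<Sum>i = 1..J. \<Sum>j = 1..J. ?X i \<omega> \<bullet> ?X j \<omega>)"
      by (simp only: power2_norm_eq_inner inner_sum_left)
        (simp only: inner_sum_right)
  qed
  also have "\<dots> = (1 / real J)\<^sup>2 * (\<Sum>i = 1..J. \<Sum>j = 1..J. \<integral>\<omega>. ?X i \<omega> \<bullet> ?X j \<omega> \<partial>M)"
  proof -
    have "(\<integral>\<omega>. (\<Sum>i = 1..J. \<Sum>j = 1..J. ?X i \<omega> \<bullet> ?X j \<omega>) \<partial>M)
        = (\<Sum>i = 1..J. \<integral>\<omega>. (\<Sum>j = 1..J. ?X i \<omega> \<bullet> ?X j \<omega>) \<partial>M)"
      by (intro Bochner_Integration.integral_sum Bochner_Integration.integrable_sum int)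
    also have "\<dots> = (\<Sum>i = 1..J. \<Sum>j = 1..J. \<integral>\<omega>. ?X i \<omega> \<bullet> ?X j \<omega> \<partial>M)"
      by (intro sum.cong refl Bochner_Integration.integral_sum int)
    finally show ?thesis by simp
  qed
  also have "\<dots> \<le> (1 / real J)\<^sup>2 * (real J * \<cc>\<^sup>2 + real J * (real J - 1) * ?h)"
  proof (rule mult_left_mono)
    have "(\<Sum>i = 1..J. \<Sum>j = 1..J. \<integral>\<omega>. ?X i \<omega> \<bullet> ?X j \<omega> \<partial>M)
        \<le> (\<Sum>i = 1..J. \<Sum>j = 1..J. if i = j then \<cc>\<^sup>2 else ?h)"
      using integral_inner_G_G second_moment_G_\<Theta>[of _ n "Suc n"]
      by (intro sum_mono) (auto simp: power2_norm_eq_inner)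
    also have "\<dots> = real J * \<cc>\<^sup>2 + real J * (real J - 1) * ?h"
      using sum_diagonal_off_diagonal[of "{1..J}" "\<lambda>i j. if i = j then \<cc>\<^sup>2 else ?h" "\<cc>\<^sup>2" ?h] by simp
    finally show "(\<Sum>i = 1..J. \<Sum>j = 1..J. \<integral>\<omega>. ?X i \<omega> \<bullet> ?X j \<omega> \<partial>M)
        \<le> real J * \<cc>\<^sup>2 + real J * (real J - 1) * ?h" .
  qed simp
  also have "\<dots> = \<cc>\<^sup>2 / real J + (real J - 1) / real J * ?h"
    using J by (simp add: field_simps power2_eq_square)
  finally show ?thesis .
qed

lemma integral_inner_m_Suc:
  assumes "Y \<in> borel_measurable (hist (past n))" "square_integrable M Y"
  shows "(\<integral>\<omega>. Y \<omega> \<bullet> m (Suc n) \<omega> \<partial>M)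
    = \<alpha> * (\<integral>\<omega>. Y \<omega> \<bullet> m n \<omega> \<partial>M) + (1 - \<alpha>) * (\<integral>\<omega>. Y \<omega> \<bullet> g (\<Theta> n \<omega>) \<partial>M)"
proof -
  have "(\<integral>\<omega>. Y \<omega> \<bullet> m (Suc n) \<omega> \<partial>M)
      = (\<integral>\<omega>. \<alpha> * (Y \<omega> \<bullet> m n \<omega>) + (1 - \<alpha>) * (Y \<omega> \<bullet> minibatch n \<omega>) \<partial>M)"
    by (intro Bochner_Integration.integral_cong)
      (auto simp: m_Suc minibatch_def inner_add_right)
  also have "\<dots> = \<alpha> * (\<integral>\<omega>. Y \<omega> \<bullet> m n \<omega> \<partial>M) + (1 - \<alpha>) * (\<integral>\<omega>. Y \<omega> \<bullet> minibatch n \<omega> \<partial>M)"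
    using square_integrable_inner[OF assms(2) square_integrable_m]
      square_integrable_inner[OF assms(2) square_integrable_minibatch]
    by (subst Bochner_Integration.integral_add) auto
  finally show ?thesis unfolding integral_inner_minibatch[OF assms] .
qed

section \<open>Recursions for the second moments\<close>

abbreviation "err n \<equiv> (\<integral>\<omega>. (norm (\<Theta> n \<omega> - \<theta>opt))\<^sup>2 \<partial>M)"
abbreviation "cor n \<equiv> (\<integral>\<omega>. (\<Theta> n \<omega> - \<theta>opt) \<bullet> m n \<omega> \<partial>M)"
abbreviation "mom n \<equiv> (\<integral>\<omega>. (norm (m n \<omega>))\<^sup>2 \<partial>M)"
abbreviation "drift n \<equiv> (\<integral>\<omega>. (\<Theta> n \<omega> - \<theta>opt) \<bullet> g (\<Theta> n \<omega>) \<partial>M)"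
abbreviation "grad n \<equiv> (\<integral>\<omega>. (norm (g (\<Theta> n \<omega>)))\<^sup>2 \<partial>M)"

lemma integrable_moments:
  shows integrable_err: "integrable M (\<lambda>\<omega>. (norm (\<Theta> n \<omega> - \<theta>opt))\<^sup>2)"
    and integrable_cor: "integrable M (\<lambda>\<omega>. (\<Theta> n \<omega> - \<theta>opt) \<bullet> m k \<omega>)"
    and integrable_mom: "integrable M (\<lambda>\<omega>. (norm (m n \<omega>))\<^sup>2)"
    and integrable_grad: "integrable M (\<lambda>\<omega>. (norm (g (\<Theta> n \<omega>)))\<^sup>2)"
  using square_integrable_error square_integrable_m square_integrable_g
    square_integrable_inner[OF square_integrable_error square_integrable_m]
  by (auto simp: square_integrable_def)

lemma error_m_Suc:
  "(\<integral>\<omega>. (\<Theta> n \<omega> - \<theta>opt) \<bullet> m (Suc n) \<omega> \<partial>M) = \<alpha> * cor n + (1 - \<alpha>) * drift n"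
  using adapted_past(1)[of n] square_integrable_error by (intro integral_inner_m_Suc) auto

lemma err_Suc:
  "err (Suc n) = err n + 2 * \<gamma> (Suc n) * (\<alpha> * cor n + (1 - \<alpha>) * drift n)
     + (\<gamma> (Suc n))\<^sup>2 * mom (Suc n)"
proof -
  have "err (Suc n) = (\<integral>\<omega>. (norm (\<Theta> n \<omega> - \<theta>opt))\<^sup>2
      + 2 * \<gamma> (Suc n) * ((\<Theta> n \<omega> - \<theta>opt) \<bullet> m (Suc n) \<omega>)
      + (\<gamma> (Suc n))\<^sup>2 * (norm (m (Suc n) \<omega>))\<^sup>2 \<partial>M)"
  proof (intro Bochner_Integration.integral_cong refl)
    fix \<omega> assume "\<omega> \<in> space M"
    then have *: "\<Theta> (Suc n) \<omega> - \<theta>opt = (\<Theta> n \<omega> - \<theta>opt) + \<gamma> (Suc n) *\<^sub>R m (Suc n) \<omega>"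
      by (simp add: \<Theta>_Suc)
    show "(norm (\<Theta> (Suc n) \<omega> - \<theta>opt))\<^sup>2 = (norm (\<Theta> n \<omega> - \<theta>opt))\<^sup>2
      + 2 * \<gamma> (Suc n) * ((\<Theta> n \<omega> - \<theta>opt) \<bullet> m (Suc n) \<omega>)
      + (\<gamma> (Suc n))\<^sup>2 * (norm (m (Suc n) \<omega>))\<^sup>2"
      using norm_power2_combination[of 1 "\<Theta> n \<omega> - \<theta>opt" "\<gamma> (Suc n)" "m (Suc n) \<omega>"] unfolding * by simp
  qed
  also have "\<dots> = err n + 2 * \<gamma> (Suc n) * (\<integral>\<omega>. (\<Theta> n \<omega> - \<theta>opt) \<bullet> m (Suc n) \<omega> \<partial>M)
      + (\<gamma> (Suc n))\<^sup>2 * mom (Suc n)"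
    using integrable_moments by simp
  finally show ?thesis by (simp add: error_m_Suc)
qed

lemma cor_Suc:
  "cor (Suc n) = \<alpha> * cor n + (1 - \<alpha>) * drift n + \<gamma> (Suc n) * mom (Suc n)"
proof -
  have "cor (Suc n) = (\<integral>\<omega>. (\<Theta> n \<omega> - \<theta>opt) \<bullet> m (Suc n) \<omega>
      + \<gamma> (Suc n) * (norm (m (Suc n) \<omega>))\<^sup>2 \<partial>M)"
    by (intro Bochner_Integration.integral_cong refl)
      (simp add: \<Theta>_Suc power2_norm_eq_inner inner_simps algebra_simps)
  also have "\<dots> = (\<integral>\<omega>. (\<Theta> n \<omega> - \<theta>opt) \<bullet> m (Suc n) \<omega> \<partial>M) + \<gamma> (Suc n) * mom (Suc n)"
    using integrable_moments by simp
  finally show ?thesis by (simp add: error_m_Suc)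
qed

text \<open>The cross term is split evenly by Young's inequality. The momentum then collects
  \<open>\<alpha>\<^sup>2 + \<alpha> * (1 - \<alpha>) = \<alpha>\<close>, and the gradient collects
  \<open>\<alpha> * (1 - \<alpha>) + (1 - \<alpha>)\<^sup>2 * (J - 1) / J\<close>, the origin of
  \<open>J - 1 + \<alpha>\<close> in \<open>N\<close>.\<close>

lemma mom_Suc_le:
  "mom (Suc n) \<le> \<alpha> * mom n + (1 - \<alpha>) * ((real J - 1 + \<alpha>) / real J) * grad n
     + (1 - \<alpha>)\<^sup>2 * (\<cc>\<^sup>2 / real J)"
proof -
  have int: "integrable M (\<lambda>\<omega>. m n \<omega> \<bullet> minibatch n \<omega>)" "integrable M (\<lambda>\<omega>. (norm (minibatch n \<omega>))\<^sup>2)"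
      "integrable M (\<lambda>\<omega>. m n \<omega> \<bullet> g (\<Theta> n \<omega>))"
    using square_integrable_inner[OF square_integrable_m square_integrable_minibatch]
      square_integrable_inner[OF square_integrable_m square_integrable_g] square_integrable_minibatch
    by (auto simp: square_integrable_def)
  have "mom (Suc n) = (\<integral>\<omega>. \<alpha>\<^sup>2 * (norm (m n \<omega>))\<^sup>2 + 2 * \<alpha> * (1 - \<alpha>) * (m n \<omega> \<bullet> minibatch n \<omega>)
      + (1 - \<alpha>)\<^sup>2 * (norm (minibatch n \<omega>))\<^sup>2 \<partial>M)"
    by (intro Bochner_Integration.integral_cong refl)
      (simp only: m_Suc minibatch_def[symmetric] norm_power2_combination)
  also have "\<dots> = \<alpha>\<^sup>2 * mom n + 2 * \<alpha> * (1 - \<alpha>) * (\<integral>\<omega>. m n \<omega> \<bullet> minibatch n \<omega> \<partial>M)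
      + (1 - \<alpha>)\<^sup>2 * (\<integral>\<omega>. (norm (minibatch n \<omega>))\<^sup>2 \<partial>M)"
    using int integrable_moments by simp
  also have "(\<integral>\<omega>. m n \<omega> \<bullet> minibatch n \<omega> \<partial>M) = (\<integral>\<omega>. m n \<omega> \<bullet> g (\<Theta> n \<omega>) \<partial>M)"
    by (rule integral_inner_minibatch[OF adapted_past(2) square_integrable_m])
  also have "(2 * \<alpha> * (1 - \<alpha>)) * (\<integral>\<omega>. m n \<omega> \<bullet> g (\<Theta> n \<omega>) \<partial>M) \<le> (2 * \<alpha> * (1 - \<alpha>)) * ((mom n + grad n) / 2)"
  proof (rule mult_left_mono)
    have "m n \<omega> \<bullet> g (\<Theta> n \<omega>) \<le> ((norm (m n \<omega>))\<^sup>2 + (norm (g (\<Theta> n \<omega>)))\<^sup>2) / 2" for \<omega>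
      using norm_cauchy_schwarz[of "m n \<omega>" "g (\<Theta> n \<omega>)"]
        sum_squares_bound[of "norm (m n \<omega>)" "norm (g (\<Theta> n \<omega>))"] by simp
    then have "(\<integral>\<omega>. m n \<omega> \<bullet> g (\<Theta> n \<omega>) \<partial>M)
        \<le> (\<integral>\<omega>. ((norm (m n \<omega>))\<^sup>2 + (norm (g (\<Theta> n \<omega>)))\<^sup>2) / 2 \<partial>M)"
      using int integrable_moments by (intro integral_mono) auto
    then show "(\<integral>\<omega>. m n \<omega> \<bullet> g (\<Theta> n \<omega>) \<partial>M) \<le> (mom n + grad n) / 2"
      using integrable_moments by simp
  qed (use \<alpha> in auto)
  also have "(1 - \<alpha>)\<^sup>2 * (\<integral>\<omega>. (norm (minibatch n \<omega>))\<^sup>2 \<partial>M)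
      \<le> (1 - \<alpha>)\<^sup>2 * (\<cc>\<^sup>2 / real J + (real J - 1) / real J * grad n)"
    by (intro mult_left_mono second_moment_minibatch) simp
  also have "\<alpha>\<^sup>2 * mom n + 2 * \<alpha> * (1 - \<alpha>) * ((mom n + grad n) / 2)
      + (1 - \<alpha>)\<^sup>2 * (\<cc>\<^sup>2 / real J + (real J - 1) / real J * grad n)
    = \<alpha> * mom n + (1 - \<alpha>) * ((real J - 1 + \<alpha>) / real J) * grad n + (1 - \<alpha>)\<^sup>2 * (\<cc>\<^sup>2 / real J)"
    using J by (simp add: field_simps power2_eq_square)
  finally show ?thesis by simp
qed

lemma drift_le: "drift n \<le> - c * err n"
proof -
  have "drift n \<le> (\<integral>\<omega>. - c * (norm (\<Theta> n \<omega> - \<theta>opt))\<^sup>2 \<partial>M)"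
    using integrable_err inner_g_le
    by (intro integral_mono square_integrable_inner square_integrable_error square_integrable_g) auto
  then show ?thesis by simp
qed

text \<open>An instance of \<open>lyapunov_contraction\<close> in which \<open>err\<close>,
  \<open>cor\<close>, \<open>mom\<close>, \<open>drift\<close> and \<open>grad\<close> at
  \<open>n\<close> play the roles of \<open>a\<close>, \<open>b\<close>, \<open>e\<close>,
  \<open>s\<close> and \<open>h\<close>, and \<open>\<cc>\<^sup>2\<close> that of
  \<open>C\<close>.\<close>

lemma lyapunov_step:
  assumes "0 < \<gamma> (Suc n)" "\<gamma> (Suc n) \<le> \<gamma> n"
    and "2 * (1 + \<alpha>) * c * \<gamma> (Suc n) \<le> 1 - \<alpha>"
    and "2 * (2 - \<alpha>) * (real J - 1 + \<alpha>) * \<gamma> (Suc n) \<le> (1 - \<alpha>)\<^sup>2 * c ^ 3 * real J"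
  shows "err (Suc n) + (1 + \<alpha>) / (1 - \<alpha>) * \<gamma> (Suc n) * max (cor (Suc n)) 0
      + 2 / (1 - \<alpha>)\<^sup>2 * (\<gamma> (Suc n))\<^sup>2 * mom (Suc n)
    \<le> (1 - (1 - \<alpha>) * c * \<gamma> (Suc n)) * (err n + (1 + \<alpha>) / (1 - \<alpha>) * \<gamma> n * max (cor n) 0
          + 2 / (1 - \<alpha>)\<^sup>2 * (\<gamma> n)\<^sup>2 * mom n)
      + 2 * (2 - \<alpha>) * (\<cc>\<^sup>2 / real J) * (\<gamma> (Suc n))\<^sup>2"
  using J c by (intro lyapunov_contraction[OF \<alpha> _ c assms(1,2) _ _ err_Suc cor_Suc mom_Suc_le drift_le
        _ second_moment_g _ assms(3,4)]) auto

end

subsection \<open>Convergence rates\<close>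

theorem theorem3p5:
  fixes M :: "'w measure"
    and J :: nat
    and U :: "nat \<Rightarrow> nat \<Rightarrow> 'w \<Rightarrow> real ^ 'e"
    and G :: "(real ^ 'd) \<times> (real ^ 'e) \<Rightarrow> real ^ 'd"
    and \<alpha> :: real
    and \<nu> :: "real ^ 'd"
    and \<gamma> :: "nat \<Rightarrow> real"
    and \<Theta> m :: "nat \<Rightarrow> 'w \<Rightarrow> real ^ 'd"
    and F :: "nat \<Rightarrow> 'w measure"
    and \<cc> c \<Gamma> \<rho> :: real
    and \<theta>opt :: "real ^ 'd"
    and N :: nat
    and V :: "nat \<Rightarrow> real"
  assumes "prob_space M"
    and "J \<ge> 1"
    and "iid_family M (\<lambda>(n, j). U n j) (UNIV \<times> {1..J})"
    and "G \<in> borel_measurable (borel \<Otimes>\<^sub>M borel)"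
    and "\<And>\<theta>. integrable M (\<lambda>\<omega>. norm (G (\<theta>, U 0 1 \<omega>)))"
    and "0 \<le> \<alpha>" and "\<alpha> < 1"
    and "\<And>n. \<gamma> n > 0"
    and "\<And>n. \<Theta> n \<in> borel_measurable M"
    and "\<And>n. m n \<in> borel_measurable M"
    and "\<And>\<omega>. \<omega> \<in> space M \<Longrightarrow> m 0 \<omega> = \<nu>"
    and "\<And>n \<omega>. n \<ge> 1 \<Longrightarrow> \<omega> \<in> space M \<Longrightarrow> \<Theta> n \<omega> = \<Theta> (n - 1) \<omega> + \<gamma> n *\<^sub>R m n \<omega>"
    and "\<And>n \<omega>. n \<ge> 1 \<Longrightarrow> \<omega> \<in> space M \<Longrightarrow>
           m n \<omega> = \<alpha> *\<^sub>R m (n - 1) \<omega>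
             + (1 - \<alpha>) *\<^sub>R ((1 / real J) *\<^sub>R (\<Sum>j = 1..J. G (\<Theta> (n - 1) \<omega>, U n j \<omega>)))"
    and "indep_of_sigma M (\<Theta> 0)
           (vimage_algebra (space M) (\<lambda>\<omega>. \<lambda>(n, j) \<in> UNIV \<times> {1..J}. U n j \<omega>)
             (Pi\<^sub>M (UNIV \<times> {1..J}) (\<lambda>_. borel)))"
    and "integrable M (\<lambda>\<omega>. (norm (\<Theta> 0 \<omega>))\<^sup>2)"
    and "\<And>n. F n = natural_filtration M \<Theta> n"
    and "\<And>n j. n \<ge> 1 \<Longrightarrow> j \<in> {1..J} \<Longrightarrow> indep_of_sigma M (U n j) (F (n - 1))"
    and "\<cc> \<ge> 0"
    and "\<And>n. integrable M (\<lambda>\<omega>. (norm (G (\<Theta> n \<omega>, U 0 1 \<omega>)))\<^sup>2)"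
    and "(SUP n. ennreal (sqrt (\<integral>\<omega>. (norm (G (\<Theta> n \<omega>, U 0 1 \<omega>)))\<^sup>2 \<partial>M))) \<le> ennreal \<cc>"
    and "c > 0"
    and "\<And>\<theta>. (\<theta> - \<theta>opt) \<bullet> (\<integral>\<omega>. G (\<theta>, U 1 1 \<omega>) \<partial>M)
           \<le> - c * max ((norm (\<theta> - \<theta>opt))\<^sup>2) ((norm (\<integral>\<omega>. G (\<theta>, U 1 1 \<omega>) \<partial>M))\<^sup>2)"
    and "\<Gamma> > 0"
    and "\<And>n. n \<ge> 1 \<Longrightarrow> \<gamma> n = \<Gamma> / real n"
    and "\<rho> = (1 - \<alpha>) * c * \<Gamma>"
    and "N = nat \<lceil>max 2 (max (2 * (1 + \<alpha>) * c * \<Gamma> / (1 - \<alpha>))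
           (2 * (2 - \<alpha>) * (real J - 1 + \<alpha>) * \<Gamma> / ((1 - \<alpha>)\<^sup>2 * c ^ 3 * real J)))\<rceil>"
    and "\<And>n. V n \<ge> 0"
    and "\<And>n. V n = (\<integral>\<omega>. (norm (\<Theta> n \<omega> - \<theta>opt))\<^sup>2 \<partial>M)
           + (1 + \<alpha>) / (1 - \<alpha>) * \<gamma> n * max (\<integral>\<omega>. (\<Theta> n \<omega> - \<theta>opt) \<bullet> m n \<omega> \<partial>M) 0
           + 2 / (1 - \<alpha>)\<^sup>2 * (\<gamma> n)\<^sup>2 * (\<integral>\<omega>. (norm (m n \<omega>))\<^sup>2 \<partial>M)"
  shows "\<forall>n::nat. n \<ge> 2 \<and> n \<ge> N \<longrightarrow>
    integrable M (\<lambda>\<omega>. (norm (\<Theta> n \<omega> - \<theta>opt))\<^sup>2) \<and>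
    (\<integral>\<omega>. (norm (\<Theta> n \<omega> - \<theta>opt))\<^sup>2 \<partial>M) \<le>
      (if \<rho> < 1 then
         V (N - 1) * (real N / (real n + 1)) powr \<rho>
         + (2 powr (\<rho> + 1) * \<Gamma>\<^sup>2 * (2 - \<alpha>) * \<cc>\<^sup>2 / ((1 - \<rho>) * (real N - 1) powr (1 - \<rho>)))
           * (1 / (real J * (real n + 1) powr \<rho>))
       else if \<rho> = 1 then
         V (N - 1) * (real N / (real n + 1))
         + (2 * \<Gamma>\<^sup>2 * (2 - \<alpha>) * \<cc>\<^sup>2) * (1 / real N + ln (real n / real N)) * (1 / (real J * real n))
       else
         V (N - 1) * (real N / (real n + 1)) powr \<rho>
         + (2 * \<Gamma>\<^sup>2 * (2 - \<alpha>) * \<cc>\<^sup>2 / (\<rho> - 1)) * (1 / (real J * real n)))"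
proof -
  have G_le: "(\<integral>\<omega>. (norm (G (\<Theta> n \<omega>, U 0 1 \<omega>)))\<^sup>2 \<partial>M) \<le> \<cc>\<^sup>2" (is "?I n \<le> _") for n
  proof -
    have "ennreal (sqrt (?I n)) \<le> ennreal \<cc>"
      by (rule order_trans[OF SUP_upper assms(20)]) simp
    then have "sqrt (?I n) \<le> \<cc>" using assms(18) by (simp add: ennreal_le_iff)
    then show ?thesis by (rule sqrt_le_D)
  qed
  interpret momentum_sgd M J U G \<alpha> \<nu> \<gamma> \<Theta> m \<cc> c \<theta>opt
  proof (intro momentum_sgd.intro momentum_sgd_axioms.intro)
    show "\<Theta> (Suc n) \<omega> = \<Theta> n \<omega> + \<gamma> (Suc n) *\<^sub>R m (Suc n) \<omega>" if "\<omega> \<in> space M" for n \<omega>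
      using assms(12)[of "Suc n" \<omega>] that by simp
    show "m (Suc n) \<omega> = \<alpha> *\<^sub>R m n \<omega>
        + (1 - \<alpha>) *\<^sub>R ((1 / real J) *\<^sub>R (\<Sum>j = 1..J. G (\<Theta> n \<omega>, U (Suc n) j \<omega>)))"
      if "\<omega> \<in> space M" for n \<omega>
      using assms(13)[of "Suc n" \<omega>] that by simp
  qed (fact assms G_le)+
  define B where "B = 2 * \<Gamma>\<^sup>2 * (2 - \<alpha>) * \<cc>\<^sup>2 / real J"
  have B: "0 \<le> B" using assms(7) by (simp add: B_def)
  have N_ge: "max 2 (max (2 * (1 + \<alpha>) * c * \<Gamma> / (1 - \<alpha>))
      (2 * (2 - \<alpha>) * (real J - 1 + \<alpha>) * \<Gamma> / ((1 - \<alpha>)\<^sup>2 * c ^ 3 * real J))) \<le> real N"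
    unfolding assms(26) by (rule real_nat_ceiling_ge)
  then have N2: "N \<ge> 2" by simp
  \<comment> \<open>The last two entries of the maximum defining \<open>N\<close>, with denominators
    cleared, are the two smallness conditions for the step size \<open>\<Gamma> / k\<close>.\<close>
  have cond1: "2 * (1 + \<alpha>) * c * \<Gamma> \<le> real k * (1 - \<alpha>)" if "k \<ge> N" for k
  proof -
    have "2 * (1 + \<alpha>) * c * \<Gamma> / (1 - \<alpha>) \<le> real k" using N_ge that by simp
    then show ?thesis using assms(7) by (simp add: pos_divide_le_eq)
  qed
  have cond2: "2 * (2 - \<alpha>) * (real J - 1 + \<alpha>) * \<Gamma> \<le> real k * ((1 - \<alpha>)\<^sup>2 * c ^ 3 * real J)"
    if "k \<ge> N" for k
  proof -
    have "2 * (2 - \<alpha>) * (real J - 1 + \<alpha>) * \<Gamma> / ((1 - \<alpha>)\<^sup>2 * c ^ 3 * real J) \<le> real k"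
      using N_ge that by simp
    moreover have "0 < (1 - \<alpha>)\<^sup>2 * c ^ 3 * real J" using assms(2,7,21) by simp
    ultimately show ?thesis by (simp only: pos_divide_le_eq)
  qed
  have step: "V k \<le> (1 - \<rho> / real k) * V (k - 1) + B / (real k)\<^sup>2" if "k \<ge> N" for k
  proof -
    \<comment> \<open>Because \<open>N \<ge> 2\<close>, the preceding index is at least 1, so the
      formula for \<open>\<gamma>\<close> also applies there; it does not determine
      \<open>\<gamma> 0\<close>.\<close>
    obtain n where n: "k = Suc n" "n \<ge> 1" using \<open>k \<ge> N\<close> N2 by (cases k) auto
    have \<gamma>: "\<gamma> (Suc n) = \<Gamma> / real k" "\<gamma> n = \<Gamma> / real n" using assms(24) n by auto
    have "V k \<le> (1 - (1 - \<alpha>) * c * \<gamma> (Suc n)) * V n + 2 * (2 - \<alpha>) * (\<cc>\<^sup>2 / real J) * (\<gamma> (Suc n))\<^sup>2"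
      unfolding n(1) assms(28)
    proof (rule lyapunov_step)
      show "0 < \<gamma> (Suc n)" by (rule assms(8))
      show "\<gamma> (Suc n) \<le> \<gamma> n" unfolding \<gamma> using assms(23) n by (intro divide_left_mono) auto
      show "2 * (1 + \<alpha>) * c * \<gamma> (Suc n) \<le> 1 - \<alpha>"
        using cond1[OF \<open>k \<ge> N\<close>] n by (simp add: \<gamma> pos_divide_le_eq mult_ac)
      show "2 * (2 - \<alpha>) * (real J - 1 + \<alpha>) * \<gamma> (Suc n) \<le> (1 - \<alpha>)\<^sup>2 * c ^ 3 * real J"
        using cond2[OF \<open>k \<ge> N\<close>] n by (simp add: \<gamma> pos_divide_le_eq mult_ac)
    qed
    also have "\<dots> = (1 - \<rho> / real k) * V (k - 1) + B / (real k)\<^sup>2"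
      by (simp add: \<gamma>(1) assms(25) n(1) B_def power_divide mult_ac)
    finally show ?thesis .
  qed
  have \<rho>: "0 < \<rho>" using assms(7,21,23,25) by simp
  \<comment> \<open>Needed for \<open>\<rho> > 1\<close>, where \<open>N \<ge> 2\<close> alone would
    not make the contraction factors nonnegative.\<close>
  have "\<rho> \<le> real N"
  proof -
    have "\<rho> \<le> 1 * (c * \<Gamma>)"
      unfolding assms(25) mult.assoc using assms(6,21,23) by (intro mult_right_mono) auto
    also have "\<dots> \<le> (2 * (1 + \<alpha>)) * (c * \<Gamma>)"
      using assms(6,21,23) by (intro mult_right_mono) auto
    also have "\<dots> \<le> real N * (1 - \<alpha>)" using cond1[of N] by (simp add: mult_ac)
    also have "\<dots> \<le> real N * 1" using assms(6) by (intro mult_left_mono) auto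
    finally show ?thesis by simp
  qed
  have err_le_V: "err n \<le> V n" for n
    unfolding assms(28) using assms(6,7) less_imp_le[OF assms(8)[of n]] by simp
  show ?thesis
  proof (intro allI impI conjI)
    fix n :: nat assume "n \<ge> 2 \<and> n \<ge> N"
    then have n: "n \<ge> N" by simp
    show "integrable M (\<lambda>\<omega>. (norm (\<Theta> n \<omega> - \<theta>opt))\<^sup>2)" by (rule integrable_err)
    note V0 = assms(27)[of "N - 1"]
    consider "\<rho> < 1" | "\<rho> = 1" | "\<rho> > 1" by linarith
    then have "V n \<le> (if \<rho> < 1 then
         V (N - 1) * (real N / (real n + 1)) powr \<rho>
         + (2 powr (\<rho> + 1) * \<Gamma>\<^sup>2 * (2 - \<alpha>) * \<cc>\<^sup>2 / ((1 - \<rho>) * (real N - 1) powr (1 - \<rho>)))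
           * (1 / (real J * (real n + 1) powr \<rho>))
       else if \<rho> = 1 then
         V (N - 1) * (real N / (real n + 1))
         + (2 * \<Gamma>\<^sup>2 * (2 - \<alpha>) * \<cc>\<^sup>2) * (1 / real N + ln (real n / real N)) * (1 / (real J * real n))
       else
         V (N - 1) * (real N / (real n + 1)) powr \<rho>
         + (2 * \<Gamma>\<^sup>2 * (2 - \<alpha>) * \<cc>\<^sup>2 / (\<rho> - 1)) * (1 / (real J * real n)))" (is "_ \<le> ?bound")
    proof cases
      case 1
      \<comment> \<open>The factor 2 in \<open>B\<close> merges with \<open>2 powr \<rho>\<close>
        into \<open>2 powr (\<rho> + 1)\<close>.\<close>
      then show ?thesis
        using recursion_bound_lt_1[OF N2 V0 B \<rho> 1 step n] by (simp add: B_def powr_add mult_ac)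
    next
      case 2
      then show ?thesis
        using recursion_bound_eq_1[OF N2 V0 B step[unfolded 2] n] by (simp add: B_def mult_ac)
    next
      case 3
      then show ?thesis
        using recursion_bound_gt_1[OF N2 V0 B 3 \<open>\<rho> \<le> real N\<close> step n] by (simp add: B_def mult_ac)
    qed
    with err_le_V show "err n \<le> ?bound" by (rule order_trans)
  qed
qed

end
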